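(* Let $(M,\varphi,\xi,\eta,g)$ be an almost contact complex Riemannian manifold. The following conditions are equivalent: (i) $(M,\varphi,\xi,\eta,g)$ is a Sasaki-like almost contact complex Riemannian manifold; (ii) the covariant derivative $\nabla\varphi$ satisfies, for all vector fields $x,y$, $(\nabla_x\varphi)y=-g(x,y)\xi-\eta(y)x+2\eta(x)\eta(y)\xi$; (iii) the Nijenhuis tensors $N$ and $\widehat N$ satisfy $N=0$ and $\widehat N=-4(\tilde g-\eta\otimes\eta)\otimes\xi$.
   Context: An almost contact complex Riemannian manifold (almost contact B-metric manifold) $(M,\varphi,\xi,\eta,g)$ is a $(2n+1)$-dimensional manifold with an endomorphism $\varphi$ of $TM$, a vector field $\xi$, a 1-form $\eta$ and a pseudo-Riemannian metric $g$ of signature $(n+1,n)$ with $\varphi\xi=0$, $\varphi^2=-I+\eta\otimes\xi$, $\eta\circ\varphi=0$, $\eta(\xi)=1$, $g(\varphi x,\varphi y)=-g(x,y)+\eta(x)\eta(y)$. The associated metric is $\tilde g(x,y)=g(x,\varphi y)+\eta(x)\eta(y)$. Let $\nabla$ be the Levi-Civita connection of $g$ and $F(x,y,z)=g((\nabla_x\varphi)y,z)$. The manifold is called Sasaki-like if for all $X,Y,Z\in\ker\eta$: $F(X,Y,Z)=F(\xi,Y,Z)=F(\xi,\xi,Z)=0$ and $F(X,Y,\xi)=-g(X,Y)$. (This is equivalent to the complex Riemannian cone over $M$ being a holomorphic complex Riemannian manifold.) $N=[\varphi,\varphi]+d\eta\otimes\xi$, where $[\varphi,\varphi](x,y)=[\varphi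 x,\varphi y]+\varphi^2[x,y]-\varphi[\varphi x,y]-\varphi[x,\varphi y]$ and $d\eta(x,y)=(\nabla_x\eta)y-(\nabla_y\eta)x$. The associated Nijenhuis tensor is $\widehat N=\{\varphi,\varphi\}+(\mathcal L_\xi g)\otimes\xi$, where $\{\varphi,\varphi\}(x,y)=\{\varphi x,\varphi y\}+\varphi^2\{x,y\}-\varphi\{\varphi x,y\}-\varphi\{x,\varphi y\}$, $\{x,y\}=\nabla_xy+\nabla_yx$, and $\mathcal L_\xi g$ is the Lie derivative, $(\mathcal L_\xi g)(x,y)=(\nabla_x\eta)y+(\nabla_y\eta)x$. *)

theory Defs
  imports "HOL-Analysis.Analysis" "HOL-Library.Function_Algebras"
begin

text \<open>Functions into a real vector space form a real vector space pointwise.  This makes the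
  operations and the notions \<^const>\<open>span\<close>, \<^const>\<open>independent\<close> available for tangent vectors and
  vector fields, both of which are functions below.\<close>

instantiation "fun" :: (type, real_vector) real_vector
begin

definition scaleR_fun :: "real \<Rightarrow> ('a \<Rightarrow> 'b) \<Rightarrow> 'a \<Rightarrow> 'b"
  where "scaleR_fun r f = (\<lambda>x. r *\<^sub>R f x)"

instance
  by standard (simp_all add: scaleR_fun_def fun_eq_iff scaleR_add_right scaleR_add_left)

end


section \<open>Smooth manifolds\<close>

text \<open>To be used on open sets only, where \<^const>\<open>frechet_derivative\<close> is uniquely determined.\<close>

primrec Ck_on :: "nat \<Rightarrow> 'e::euclidean_space set \<Rightarrow> ('e \<Rightarrow> 'b::real_normed_vector) \<Rightarrow> bool" where
  "Ck_on 0 S f \<longleftrightarrow> continuous_on S f"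
| "Ck_on (Suc k) S f \<longleftrightarrow>
     f differentiable_on S \<and> (\<forall>v\<in>Basis. Ck_on k S (\<lambda>x. frechet_derivative f (at x) v))"

definition smooth_on :: "'e::euclidean_space set \<Rightarrow> ('e \<Rightarrow> 'b::real_normed_vector) \<Rightarrow> bool"
  where "smooth_on S f \<longleftrightarrow> (\<forall>k. Ck_on k S f)"

text \<open>The underlying set of the manifold is the universe of the type \<open>'m\<close>, its topology is that
  of the type, and the Hausdorff and second countability axioms are the sort constraints.  A chart
  is a pair of its domain and its coordinate map, whose values outside the domain are irrelevant.\<close>

type_synonym ('m, 'e) atlas = "('m set \<times> ('m \<Rightarrow> 'e)) set"

definition smooth_atlas ::
  "('m::{t2_space, second_countable_topology}, 'e::euclidean_space) atlas \<Rightarrow> bool"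
  where "smooth_atlas A \<longleftrightarrow>
    (\<Union>(U, c)\<in>A. U) = UNIV \<and>
    (\<forall>(U, c)\<in>A. open U \<and> open (c ` U) \<and> homeomorphism U (c ` U) c (inv_into U c)) \<and>
    (\<forall>(U, c)\<in>A. \<forall>(V, d)\<in>A. smooth_on (c ` (U \<inter> V)) (d \<circ> inv_into U c))"

definition smooth_fun ::
  "('m::{t2_space, second_countable_topology}, 'e::euclidean_space) atlas \<Rightarrow> ('m \<Rightarrow> real) \<Rightarrow> bool"
  where "smooth_fun A f \<longleftrightarrow> (\<forall>(U, c)\<in>A. smooth_on (c ` U) (f \<circ> inv_into U c))"


section \<open>Tangent vectors and vector fields\<close>

type_synonym 'm tvec = "('m \<Rightarrow> real) \<Rightarrow> real"
type_synonym 'm vfield = "'m \<Rightarrow> 'm tvec"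

text \<open>Tangent vectors at \<open>p\<close> are the derivations at \<open>p\<close> of the algebra of smooth functions.  As HOL
  functions are total, they are normalised to vanish on functions that are not smooth, so that
  equality of tangent vectors is equality of derivations.\<close>

definition tangent_space ::
  "('m::{t2_space, second_countable_topology}, 'e::euclidean_space) atlas \<Rightarrow> 'm \<Rightarrow> 'm tvec set"
  where "tangent_space A p = {v.
    (\<forall>f h. smooth_fun A f \<longrightarrow> smooth_fun A h \<longrightarrow> v (\<lambda>q. f q + h q) = v f + v h) \<and>
    (\<forall>r f. smooth_fun A f \<longrightarrow> v (\<lambda>q. r * f q) = r * v f) \<and>
    (\<forall>f h. smooth_fun A f \<longrightarrow> smooth_fun A h \<longrightarrow>
        v (\<lambda>q. f q * h q) = f p * v h + h p * v f) \<and>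
    (\<forall>f. \<not> smooth_fun A f \<longrightarrow> v f = 0)}"

definition vf_deriv :: "'m vfield \<Rightarrow> ('m \<Rightarrow> real) \<Rightarrow> 'm \<Rightarrow> real"
  where "vf_deriv X f = (\<lambda>p. X p f)"

definition vector_field ::
  "('m::{t2_space, second_countable_topology}, 'e::euclidean_space) atlas \<Rightarrow> 'm vfield \<Rightarrow> bool"
  where "vector_field A X \<longleftrightarrow>
    (\<forall>p. X p \<in> tangent_space A p) \<and> (\<forall>f. smooth_fun A f \<longrightarrow> smooth_fun A (vf_deriv X f))"

definition fscale :: "('m \<Rightarrow> real) \<Rightarrow> 'm vfield \<Rightarrow> 'm vfield"  (infixr "\<cdot>" 75)
  where "f \<cdot> X = (\<lambda>p. f p *\<^sub>R X p)"

definition lie_bracket :: "'m vfield \<Rightarrow> 'm vfield \<Rightarrow> 'm vfield"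
  where "lie_bracket X Y = (\<lambda>p f. X p (vf_deriv Y f) - Y p (vf_deriv X f))"


section \<open>Tensor fields\<close>

text \<open>Tensor fields are families of linear maps on the tangent spaces; their values outside the
  tangent spaces are irrelevant.  They are smooth if they take smooth vector fields to smooth
  objects.\<close>

definition app :: "('m \<Rightarrow> 'm tvec \<Rightarrow> 'b) \<Rightarrow> 'm vfield \<Rightarrow> 'm \<Rightarrow> 'b"
  where "app T X = (\<lambda>p. T p (X p))"

definition app2 :: "('m \<Rightarrow> 'm tvec \<Rightarrow> 'm tvec \<Rightarrow> 'b) \<Rightarrow> 'm vfield \<Rightarrow> 'm vfield \<Rightarrow> 'm \<Rightarrow> 'b"
  where "app2 T X Y = (\<lambda>p. T p (X p) (Y p))"

definition endomorphism_field ::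
  "('m::{t2_space, second_countable_topology}, 'e::euclidean_space) atlas
     \<Rightarrow> ('m \<Rightarrow> 'm tvec \<Rightarrow> 'm tvec) \<Rightarrow> bool"
  where "endomorphism_field A \<phi> \<longleftrightarrow>
    (\<forall>p. \<forall>v\<in>tangent_space A p. \<phi> p v \<in> tangent_space A p) \<and>
    (\<forall>p. \<forall>v\<in>tangent_space A p. \<forall>w\<in>tangent_space A p. \<phi> p (v + w) = \<phi> p v + \<phi> p w) \<and>
    (\<forall>p r. \<forall>v\<in>tangent_space A p. \<phi> p (r *\<^sub>R v) = r *\<^sub>R \<phi> p v) \<and>
    (\<forall>X. vector_field A X \<longrightarrow> vector_field A (app \<phi> X))"

definition one_form ::
  "('m::{t2_space, second_countable_topology}, 'e::euclidean_space) atlas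
     \<Rightarrow> ('m \<Rightarrow> 'm tvec \<Rightarrow> real) \<Rightarrow> bool"
  where "one_form A \<eta> \<longleftrightarrow>
    (\<forall>p. \<forall>v\<in>tangent_space A p. \<forall>w\<in>tangent_space A p. \<eta> p (v + w) = \<eta> p v + \<eta> p w) \<and>
    (\<forall>p r. \<forall>v\<in>tangent_space A p. \<eta> p (r *\<^sub>R v) = r * \<eta> p v) \<and>
    (\<forall>X. vector_field A X \<longrightarrow> smooth_fun A (app \<eta> X))"

definition symmetric_tensor ::
  "('m::{t2_space, second_countable_topology}, 'e::euclidean_space) atlas
     \<Rightarrow> ('m \<Rightarrow> 'm tvec \<Rightarrow> 'm tvec \<Rightarrow> real) \<Rightarrow> bool"
  where "symmetric_tensor A g \<longleftrightarrow>
    (\<forall>p. \<forall>v\<in>tangent_space A p. \<forall>w\<in>tangent_space A p. g p v w = g p w v) \<and>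
    (\<forall>p. \<forall>u\<in>tangent_space A p. \<forall>v\<in>tangent_space A p. \<forall>w\<in>tangent_space A p.
        g p (u + v) w = g p u w + g p v w) \<and>
    (\<forall>p r. \<forall>v\<in>tangent_space A p. \<forall>w\<in>tangent_space A p. g p (r *\<^sub>R v) w = r * g p v w) \<and>
    (\<forall>X Y. vector_field A X \<longrightarrow> vector_field A Y \<longrightarrow> smooth_fun A (app2 g X Y))"

text \<open>Existence of a pseudo-orthonormal basis with \<open>k\<close> vectors of square \<open>1\<close> and \<open>l\<close> of
  square \<open>-1\<close>.\<close>

definition has_signature :: "'v::real_vector set \<Rightarrow> ('v \<Rightarrow> 'v \<Rightarrow> real) \<Rightarrow> nat \<Rightarrow> nat \<Rightarrow> bool"
  where "has_signature V b k l \<longleftrightarrow> (\<exists>P Q.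
    finite P \<and> finite Q \<and> P \<inter> Q = {} \<and> card P = k \<and> card Q = l \<and>
    independent (P \<union> Q) \<and> span (P \<union> Q) = V \<and>
    (\<forall>u\<in>P \<union> Q. \<forall>v\<in>P \<union> Q. u \<noteq> v \<longrightarrow> b u v = 0) \<and>
    (\<forall>u\<in>P. b u u = 1) \<and> (\<forall>u\<in>Q. b u u = -1))"

definition pseudo_riemannian_metric ::
  "('m::{t2_space, second_countable_topology}, 'e::euclidean_space) atlas \<Rightarrow> nat \<Rightarrow> nat
     \<Rightarrow> ('m \<Rightarrow> 'm tvec \<Rightarrow> 'm tvec \<Rightarrow> real) \<Rightarrow> bool"
  where "pseudo_riemannian_metric A k l g \<longleftrightarrow>
    symmetric_tensor A g \<and> (\<forall>p. has_signature (tangent_space A p) (g p) k l)"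

definition lie_derivative_metric ::
  "'m vfield \<Rightarrow> ('m \<Rightarrow> 'm tvec \<Rightarrow> 'm tvec \<Rightarrow> real) \<Rightarrow> 'm vfield \<Rightarrow> 'm vfield \<Rightarrow> 'm \<Rightarrow> real"
  where "lie_derivative_metric Z g X Y =
    vf_deriv Z (app2 g X Y) - app2 g (lie_bracket Z X) Y - app2 g X (lie_bracket Z Y)"


section \<open>The Levi-Civita connection\<close>

text \<open>A connection is a map on pairs of vector fields; its values on arguments that are not smooth
  vector fields are irrelevant.  Real linearity in the second argument is the Leibniz rule for
  constant functions.\<close>

definition affine_connection ::
  "('m::{t2_space, second_countable_topology}, 'e::euclidean_space) atlas
     \<Rightarrow> ('m vfield \<Rightarrow> 'm vfield \<Rightarrow> 'm vfield) \<Rightarrow> bool"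
  where "affine_connection A D \<longleftrightarrow>
    (\<forall>X Y. vector_field A X \<longrightarrow> vector_field A Y \<longrightarrow> vector_field A (D X Y)) \<and>
    (\<forall>X Y Z. vector_field A X \<longrightarrow> vector_field A Y \<longrightarrow> vector_field A Z \<longrightarrow>
        D (X + Y) Z = D X Z + D Y Z \<and> D X (Y + Z) = D X Y + D X Z) \<and>
    (\<forall>f X Y. smooth_fun A f \<longrightarrow> vector_field A X \<longrightarrow> vector_field A Y \<longrightarrow>
        D (f \<cdot> X) Y = f \<cdot> D X Y \<and> D X (f \<cdot> Y) = vf_deriv X f \<cdot> Y + f \<cdot> D X Y)"

definition levi_civita ::
  "('m::{t2_space, second_countable_topology}, 'e::euclidean_space) atlas
     \<Rightarrow> ('m \<Rightarrow> 'm tvec \<Rightarrow> 'm tvec \<Rightarrow> real) \<Rightarrow> ('m vfield \<Rightarrow> 'm vfield \<Rightarrow> 'm vfield) \<Rightarrow> bool"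
  where "levi_civita A g D \<longleftrightarrow>
    affine_connection A D \<and>
    (\<forall>X Y. vector_field A X \<longrightarrow> vector_field A Y \<longrightarrow> D X Y - D Y X = lie_bracket X Y) \<and>
    (\<forall>X Y Z. vector_field A X \<longrightarrow> vector_field A Y \<longrightarrow> vector_field A Z \<longrightarrow>
        vf_deriv X (app2 g Y Z) = app2 g (D X Y) Z + app2 g Y (D X Z))"

definition nabla_endo ::
  "('m vfield \<Rightarrow> 'm vfield \<Rightarrow> 'm vfield) \<Rightarrow> ('m \<Rightarrow> 'm tvec \<Rightarrow> 'm tvec)
     \<Rightarrow> 'm vfield \<Rightarrow> 'm vfield \<Rightarrow> 'm vfield"
  where "nabla_endo D \<phi> X Y = D X (app \<phi> Y) - app \<phi> (D X Y)"

definition nabla_form ::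
  "('m vfield \<Rightarrow> 'm vfield \<Rightarrow> 'm vfield) \<Rightarrow> ('m \<Rightarrow> 'm tvec \<Rightarrow> real)
     \<Rightarrow> 'm vfield \<Rightarrow> 'm vfield \<Rightarrow> 'm \<Rightarrow> real"
  where "nabla_form D \<eta> X Y = vf_deriv X (app \<eta> Y) - app \<eta> (D X Y)"


section \<open>Almost contact complex Riemannian manifolds\<close>

definition almost_contact_complex_riemannian ::
  "nat \<Rightarrow> ('m::{t2_space, second_countable_topology}, 'e::euclidean_space) atlas
     \<Rightarrow> ('m \<Rightarrow> 'm tvec \<Rightarrow> 'm tvec) \<Rightarrow> 'm vfield \<Rightarrow> ('m \<Rightarrow> 'm tvec \<Rightarrow> real)
     \<Rightarrow> ('m \<Rightarrow> 'm tvec \<Rightarrow> 'm tvec \<Rightarrow> real) \<Rightarrow> bool"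
  where "almost_contact_complex_riemannian n A \<phi> \<xi> \<eta> g \<longleftrightarrow>
    DIM('e) = 2 * n + 1 \<and> smooth_atlas A \<and>
    endomorphism_field A \<phi> \<and> vector_field A \<xi> \<and> one_form A \<eta> \<and>
    pseudo_riemannian_metric A (n + 1) n g \<and>
    (\<forall>p. \<phi> p (\<xi> p) = 0 \<and> \<eta> p (\<xi> p) = 1) \<and>
    (\<forall>p. \<forall>v\<in>tangent_space A p. \<phi> p (\<phi> p v) = - v + \<eta> p v *\<^sub>R \<xi> p \<and> \<eta> p (\<phi> p v) = 0) \<and>
    (\<forall>p. \<forall>v\<in>tangent_space A p. \<forall>w\<in>tangent_space A p.
        g p (\<phi> p v) (\<phi> p w) = - g p v w + \<eta> p v * \<eta> p w)"

definition associated_metric ::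
  "('m \<Rightarrow> 'm tvec \<Rightarrow> 'm tvec) \<Rightarrow> ('m \<Rightarrow> 'm tvec \<Rightarrow> real)
     \<Rightarrow> ('m \<Rightarrow> 'm tvec \<Rightarrow> 'm tvec \<Rightarrow> real) \<Rightarrow> 'm \<Rightarrow> 'm tvec \<Rightarrow> 'm tvec \<Rightarrow> real"
  where "associated_metric \<phi> \<eta> g p v w = g p v (\<phi> p w) + \<eta> p v * \<eta> p w"

definition fundamental_tensor ::
  "('m vfield \<Rightarrow> 'm vfield \<Rightarrow> 'm vfield) \<Rightarrow> ('m \<Rightarrow> 'm tvec \<Rightarrow> 'm tvec)
     \<Rightarrow> ('m \<Rightarrow> 'm tvec \<Rightarrow> 'm tvec \<Rightarrow> real) \<Rightarrow> 'm vfield \<Rightarrow> 'm vfield \<Rightarrow> 'm vfield \<Rightarrow> 'm \<Rightarrow> real"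
  where "fundamental_tensor D \<phi> g X Y Z = app2 g (nabla_endo D \<phi> X Y) Z"

definition horizontal ::
  "('m::{t2_space, second_countable_topology}, 'e::euclidean_space) atlas
     \<Rightarrow> ('m \<Rightarrow> 'm tvec \<Rightarrow> real) \<Rightarrow> 'm vfield \<Rightarrow> bool"
  where "horizontal A \<eta> X \<longleftrightarrow> vector_field A X \<and> app \<eta> X = 0"

definition sasaki_like ::
  "('m::{t2_space, second_countable_topology}, 'e::euclidean_space) atlas
     \<Rightarrow> ('m \<Rightarrow> 'm tvec \<Rightarrow> 'm tvec) \<Rightarrow> 'm vfield \<Rightarrow> ('m \<Rightarrow> 'm tvec \<Rightarrow> real)
     \<Rightarrow> ('m \<Rightarrow> 'm tvec \<Rightarrow> 'm tvec \<Rightarrow> real) \<Rightarrow> ('m vfield \<Rightarrow> 'm vfield \<Rightarrow> 'm vfield) \<Rightarrow> bool"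
  where "sasaki_like A \<phi> \<xi> \<eta> g D \<longleftrightarrow>
    (\<forall>X Y Z. horizontal A \<eta> X \<longrightarrow> horizontal A \<eta> Y \<longrightarrow> horizontal A \<eta> Z \<longrightarrow>
        fundamental_tensor D \<phi> g X Y Z = 0 \<and>
        fundamental_tensor D \<phi> g \<xi> Y Z = 0 \<and>
        fundamental_tensor D \<phi> g \<xi> \<xi> Z = 0 \<and>
        fundamental_tensor D \<phi> g X Y \<xi> = - app2 g X Y)"

text \<open>For torsion-free \<open>D\<close> this is the exterior derivative without the factor \<open>1/2\<close>, that is
  \<open>X (\<eta> Y) - Y (\<eta> X) - \<eta> [X, Y]\<close>.\<close>

definition exterior_derivative ::
  "('m vfield \<Rightarrow> 'm vfield \<Rightarrow> 'm vfield) \<Rightarrow> ('m \<Rightarrow> 'm tvec \<Rightarrow> real)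
     \<Rightarrow> 'm vfield \<Rightarrow> 'm vfield \<Rightarrow> 'm \<Rightarrow> real"
  where "exterior_derivative D \<eta> X Y = nabla_form D \<eta> X Y - nabla_form D \<eta> Y X"

definition sym_bracket ::
  "('m vfield \<Rightarrow> 'm vfield \<Rightarrow> 'm vfield) \<Rightarrow> 'm vfield \<Rightarrow> 'm vfield \<Rightarrow> 'm vfield"
  where "sym_bracket D X Y = D X Y + D Y X"

text \<open>The common shape of \<open>[\<phi>,\<phi>]\<close> and \<open>{\<phi>,\<phi>}\<close>, for a given bracket \<open>B\<close> of vector fields.\<close>

definition nijenhuis_of_bracket ::
  "('m vfield \<Rightarrow> 'm vfield \<Rightarrow> 'm vfield) \<Rightarrow> ('m \<Rightarrow> 'm tvec \<Rightarrow> 'm tvec)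
     \<Rightarrow> 'm vfield \<Rightarrow> 'm vfield \<Rightarrow> 'm vfield"
  where "nijenhuis_of_bracket B \<phi> X Y =
    B (app \<phi> X) (app \<phi> Y) + app \<phi> (app \<phi> (B X Y)) - app \<phi> (B (app \<phi> X) Y) - app \<phi> (B X (app \<phi> Y))"

definition nijenhuis_tensor ::
  "('m vfield \<Rightarrow> 'm vfield \<Rightarrow> 'm vfield) \<Rightarrow> ('m \<Rightarrow> 'm tvec \<Rightarrow> 'm tvec) \<Rightarrow> 'm vfield
     \<Rightarrow> ('m \<Rightarrow> 'm tvec \<Rightarrow> real) \<Rightarrow> 'm vfield \<Rightarrow> 'm vfield \<Rightarrow> 'm vfield"
  where "nijenhuis_tensor D \<phi> \<xi> \<eta> X Y =
    nijenhuis_of_bracket lie_bracket \<phi> X Y + exterior_derivative D \<eta> X Y \<cdot> \<xi>"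

definition associated_nijenhuis_tensor ::
  "('m vfield \<Rightarrow> 'm vfield \<Rightarrow> 'm vfield) \<Rightarrow> ('m \<Rightarrow> 'm tvec \<Rightarrow> 'm tvec) \<Rightarrow> 'm vfield
     \<Rightarrow> ('m \<Rightarrow> 'm tvec \<Rightarrow> 'm tvec \<Rightarrow> real) \<Rightarrow> 'm vfield \<Rightarrow> 'm vfield \<Rightarrow> 'm vfield"
  where "associated_nijenhuis_tensor D \<phi> \<xi> g X Y =
    nijenhuis_of_bracket (sym_bracket D) \<phi> X Y + lie_derivative_metric \<xi> g X Y \<cdot> \<xi>"

end

theory Submission
  imports Defs
begin

text \<open>All three conditions are pointwise statements about the tensor \<open>F (x, y, z) = g ((\<nabla>\<^sub>x \<phi>) y, z)\<close>, which is
  symmetric in \<open>y\<close> and \<open>z\<close> because \<open>\<phi>\<close> is self-adjoint.  Paired with a third vector field, the formula for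
  \<open>\<nabla>\<phi>\<close> says
  \<open>F (x, y, z) = - g (x, y) \<eta> (z) - \<eta> (y) g (x, z) + 2 \<eta> (x) \<eta> (y) \<eta> (z)\<close>.

  The Sasaki-like condition prescribes \<open>F\<close> on horizontal fields and \<open>\<xi>\<close>.  Since
  \<open>F (x, \<xi>, \<xi>) = 0\<close> always, splitting the three arguments into horizontal and vertical parts shows that the
  prescribed components are all components, and that they are those of the formula.

  For the Nijenhuis tensors put \<open>P (x, y) = (\<nabla>\<^bsub>\<phi> x\<^esub> \<phi>) y - \<phi> ((\<nabla>\<^sub>x \<phi>) y)\<close>.  As the connection is
  torsion-free, \<open>[\<phi>,\<phi>] (x, y) = P (x, y) - P (y, x)\<close> and \<open>{\<phi>,\<phi>} (x, y) = P (x, y) + P (y, x)\<close>, so the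
  two conditions together determine \<open>P\<close> in terms of \<open>\<nabla>\<eta>\<close>.  From \<open>P\<close> one recovers \<open>F\<close>: on horizontal
  fields \<open>F (\<phi> x, y, z) = F (x, y, \<phi> z)\<close>, and \<open>\<phi>\<close> moves from \<open>z\<close> to \<open>y\<close> both with sign \<open>+\<close>, by the symmetry
  of \<open>F\<close>, and with sign \<open>-\<close>, by differentiating \<open>\<phi>\<^sup>2 = - I + \<eta> \<otimes> \<xi>\<close>.  So the horizontal part vanishes; the
  components with one \<open>\<xi>\<close> yield \<open>(\<nabla>\<^sub>x \<eta>) y = - g (x, \<phi> y)\<close> and then agree with the formula.

  A vector field must be recovered from its products with vector fields.  The metric is nondegenerate on each
  tangent space, but this only helps if every tangent vector is the value of a smooth vector field
  (\<open>tangent_vector_extends\<close>).  Coordinate fields multiplied by bump functions are smooth vector fields, and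
  they span the tangent space because its dimension is known from the signature.  This analytic part,
  ending with \<open>metric_nondegenerate\<close>, is independent of the contact structure.\<close>

section \<open>Calculus of \<open>k\<close> times continuously differentiable functions on open sets\<close>

lemma Ck_on_Suc_has_derivative:
  assumes "open S" "Ck_on (Suc k) S f" "x \<in> S"
  shows "(f has_derivative frechet_derivative f (at x)) (at x)"
  using assms by (simp add: differentiable_on_eq_differentiable_at frechet_derivative_works)

lemma Ck_on_cong:
  fixes f :: "'e::euclidean_space \<Rightarrow> 'b::real_normed_vector"
  assumes "open S" "\<And>x. x \<in> S \<Longrightarrow> f x = g x" "Ck_on k S f"
  shows "Ck_on k S g"
  using assms(2,3)
proof (induction k arbitrary: f g)
  case 0
  then show ?case using continuous_on_cong[of S S f g] by simp
next
  case (Suc k)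
  let ?f' = "\<lambda>x. frechet_derivative f (at x)"
  have g: "(g has_derivative ?f' x) (at x)" if "x \<in> S" for x
    using has_derivative_transform_within_open[OF Ck_on_Suc_has_derivative[OF \<open>open S\<close> Suc.prems(2) that]
        \<open>open S\<close> that] Suc.prems(1) by blast
  have "g differentiable_on S"
    using g \<open>open S\<close> by (auto simp: differentiable_on_eq_differentiable_at differentiable_def)
  moreover have "Ck_on k S (\<lambda>x. frechet_derivative g (at x) v)" if "v \<in> Basis" for v
  proof (rule Suc.IH)
    show "Ck_on k S (\<lambda>x. ?f' x v)" using Suc.prems(2) that by simp
  qed (simp add: frechet_derivative_at[OF g, symmetric])
  ultimately show ?case by simp
qed

text \<open>The class of a function is computed from any explicit family of derivatives; \<^const>\<open>frechet_derivative\<close>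
  then need not be evaluated at each step of the inductions below.\<close>

lemma Ck_on_SucI:
  fixes f :: "'e::euclidean_space \<Rightarrow> 'b::real_normed_vector"
  assumes "open S" and f': "\<And>x. x \<in> S \<Longrightarrow> (f has_derivative f' x) (at x)"
    and k: "\<And>v. v \<in> Basis \<Longrightarrow> Ck_on k S (\<lambda>x. f' x v)"
  shows "Ck_on (Suc k) S f"
proof -
  have "f differentiable_on S"
    using f' \<open>open S\<close> by (auto simp: differentiable_on_eq_differentiable_at differentiable_def)
  moreover have "Ck_on k S (\<lambda>x. frechet_derivative f (at x) v)" if "v \<in> Basis" for v
    by (rule Ck_on_cong[OF \<open>open S\<close> _ k[OF that]]) (simp add: frechet_derivative_at[OF f', symmetric])
  ultimately show ?thesis by simp
qed

lemma Ck_on_subset: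
  assumes "open T" "T \<subseteq> S" "Ck_on k S f"
  shows "Ck_on k T f"
  using assms(3)
  by (induction k arbitrary: f)
     (use assms(2) in \<open>auto intro: continuous_on_subset differentiable_on_subset\<close>)

lemma Ck_on_local:
  assumes "open S" "\<And>x. x \<in> S \<Longrightarrow> \<exists>T. open T \<and> x \<in> T \<and> Ck_on k T f"
  shows "Ck_on k S f"
  using assms(2)
proof (induction k arbitrary: f)
  case 0
  then show ?case
    by (metis Ck_on.simps(1) at_within_open_subset continuous_at_imp_continuous_on
        continuous_on_eq_continuous_at)
next
  case (Suc k)
  have "f differentiable at x" if "x \<in> S" for x
    using Suc.prems[OF that] by (auto simp: differentiable_on_eq_differentiable_at)
  moreover have "Ck_on k S (\<lambda>x. frechet_derivative f (at x) v)" if "v \<in> Basis" for v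
    using Suc.prems that by (intro Suc.IH) fastforce
  ultimately show ?case
    using \<open>open S\<close> by (simp add: differentiable_on_eq_differentiable_at)
qed

lemma Ck_on_SucD:
  assumes "open S" "Ck_on (Suc k) S f"
  shows "Ck_on k S f"
  using assms(2)
proof (induction k arbitrary: f)
  case 0
  then show ?case by (simp add: differentiable_imp_continuous_on)
qed auto

lemma Ck_on_const: "Ck_on k S (\<lambda>x. c)"
  by (induction k arbitrary: c) (auto simp: frechet_derivative_const)

lemma Ck_on_bounded_linear:
  assumes "open S" "bounded_linear L" "Ck_on k S f"
  shows "Ck_on k S (\<lambda>x. L (f x))"
  using assms(3)
proof (induction k arbitrary: f)
  case 0
  then show ?case by (simp add: assms(2) bounded_linear.continuous_on)
next
  case (Suc k)
  show ?case
  proof (rule Ck_on_SucI[OF assms(1)])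
    show "((\<lambda>x. L (f x)) has_derivative (\<lambda>v. L (frechet_derivative f (at x) v))) (at x)"
      if "x \<in> S" for x
      by (rule bounded_linear.has_derivative[OF assms(2)
            Ck_on_Suc_has_derivative[OF assms(1) Suc.prems that]])
  qed (use Suc in auto)
qed

lemma Ck_on_add:
  assumes "open S" "Ck_on k S f" "Ck_on k S g"
  shows "Ck_on k S (\<lambda>x. f x + g x)"
  using assms(2,3)
proof (induction k arbitrary: f g)
  case 0
  then show ?case by (simp add: continuous_on_add)
next
  case (Suc k)
  show ?case
  proof (rule Ck_on_SucI[OF assms(1)])
    show "((\<lambda>x. f x + g x) has_derivative
        (\<lambda>v. frechet_derivative f (at x) v + frechet_derivative g (at x) v)) (at x)"
      if "x \<in> S" for x
      using Suc.prems by (intro has_derivative_add Ck_on_Suc_has_derivative[OF assms(1) _ that, where k = k])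
  qed (use Suc in auto)
qed

lemma Ck_on_sum:
  assumes "open S" "finite I" "\<And>i. i \<in> I \<Longrightarrow> Ck_on k S (f i)"
  shows "Ck_on k S (\<lambda>x. \<Sum>i\<in>I. f i x)"
  using assms(2,3)
  by (induction rule: finite_induct) (auto simp: Ck_on_const intro: Ck_on_add[OF assms(1)])

lemma Ck_on_bilinear:
  assumes "open S" "bounded_bilinear B" "Ck_on k S f" "Ck_on k S g"
  shows "Ck_on k S (\<lambda>x. B (f x) (g x))"
  using assms(3,4)
proof (induction k arbitrary: f g)
  case 0
  then show ?case by (simp add: assms(2) bounded_bilinear.continuous_on)
next
  case (Suc k)
  show ?case
  proof (rule Ck_on_SucI[OF assms(1)])
    show "((\<lambda>x. B (f x) (g x)) has_derivative
        (\<lambda>v. B (f x) (frechet_derivative g (at x) v) + B (frechet_derivative f (at x) v) (g x))) (at x)"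
      if "x \<in> S" for x
      using Suc.prems
      by (intro bounded_bilinear.FDERIV[OF assms(2)] Ck_on_Suc_has_derivative[OF assms(1) _ that, where k = k])
    show "Ck_on k S (\<lambda>x. B (f x) (frechet_derivative g (at x) v) + B (frechet_derivative f (at x) v) (g x))"
      if "v \<in> Basis" for v
      using Suc.prems that
      by (intro Ck_on_add Suc.IH assms(1)) (use Ck_on_SucD[OF assms(1)] in auto)
  qed
qed

text \<open>Each partial derivative of the composition is, by the chain rule in coordinates, a sum of products of
  components of a derivative of \<open>h\<close> with partial derivatives of \<open>f\<close> composed with \<open>h\<close>, so the
  induction on \<open>k\<close> closes for all \<open>f\<close> at once.\<close>

lemma Ck_on_compose:
  assumes S: "open S" and T: "open T" and "Ck_on k T f" "Ck_on k S h" and hS: "h ` S \<subseteq> T"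
  shows "Ck_on k S (\<lambda>x. f (h x))"
  using assms(3,4)
proof (induction k arbitrary: f)
  case 0
  then show ?case using hS continuous_on_compose2[of T f S h] by simp
next
  case (Suc k)
  let ?f' = "\<lambda>y. frechet_derivative f (at y)" and ?h' = "\<lambda>x. frechet_derivative h (at x)"
  show ?case
  proof (rule Ck_on_SucI[OF S])
    fix x assume x: "x \<in> S"
    have h: "(h has_derivative ?h' x) (at x)"
      and f: "(f has_derivative ?f' (h x)) (at (h x))"
      using Ck_on_Suc_has_derivative[OF S Suc.prems(2) x]
        Ck_on_Suc_has_derivative[OF T Suc.prems(1), of "h x"] hS x by auto
    have "?f' (h x) (?h' x v) = (\<Sum>e\<in>Basis. (?h' x v \<bullet> e) *\<^sub>R ?f' (h x) e)" for v
    proof -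
      have "?f' (h x) (\<Sum>e\<in>Basis. (?h' x v \<bullet> e) *\<^sub>R e) = (\<Sum>e\<in>Basis. (?h' x v \<bullet> e) *\<^sub>R ?f' (h x) e)"
        using has_derivative_linear[OF f] by (simp add: linear_sum linear_cmul)
      then show ?thesis by (simp add: euclidean_representation)
    qed
    then show "((\<lambda>x. f (h x)) has_derivative
        (\<lambda>v. \<Sum>e\<in>Basis. (?h' x v \<bullet> e) *\<^sub>R ?f' (h x) e)) (at x)"
      using has_derivative_compose[OF h f] by simp
  next
    fix v :: 'a assume v: "v \<in> Basis"
    show "Ck_on k S (\<lambda>x. \<Sum>e\<in>Basis. (?h' x v \<bullet> e) *\<^sub>R ?f' (h x) e)"
    proof (intro Ck_on_sum[OF S] finite_Basis Ck_on_bilinear[OF S bounded_bilinear_scaleR])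
      fix e :: 'b assume e: "e \<in> Basis"
      show "Ck_on k S (\<lambda>x. ?h' x v \<bullet> e)"
        using Suc.prems(2) v by (intro Ck_on_bounded_linear[OF S bounded_linear_inner_left]) simp
      show "Ck_on k S (\<lambda>x. ?f' (h x) e)"
        using Suc.prems e Ck_on_SucD[OF S] by (intro Suc.IH) auto
    qed
  qed
qed

lemma Ck_on_id: "open S \<Longrightarrow> Ck_on k S (\<lambda>x. x)"
  by (cases k) (auto intro: Ck_on_SucI Ck_on_const has_derivative_ident simp: continuous_on_id)

section \<open>Bump functions\<close>

text \<open>The factor \<open>1/t^j\<close> makes the family closed under differentiation:
  the derivative of each member is a linear combination of two later members.  Smoothness of
  \<open>exp (-1/t)\<close>, extended by zero, is then one induction over \<open>k\<close> for all \<open>j\<close>.\<close>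

definition flat :: "nat \<Rightarrow> real \<Rightarrow> real"
  where "flat j t = (if t > 0 then inverse t ^ j * exp (- inverse t) else 0)"

lemma flat_tendsto_0: "((\<lambda>t. flat j t) \<longlongrightarrow> 0) (at 0)"
proof -
  have "((\<lambda>t. inverse t ^ j * exp (- inverse t)) \<longlongrightarrow> 0) (at_right (0::real))"
  proof -
    have "((\<lambda>x::real. x ^ j / exp x) \<longlongrightarrow> 0) at_top"
      by (rule tendsto_power_div_exp_0)
    then have "((\<lambda>t::real. inverse t ^ j / exp (inverse t)) \<longlongrightarrow> 0) (at_right 0)"
      by (rule filterlim_compose[OF _ filterlim_inverse_at_top_right])
    then show ?thesis by (simp add: exp_minus field_simps)
  qed
  then have "(flat j \<longlongrightarrow> 0) (at_right 0)"
    by (rule Lim_transform_eventually)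
       (auto simp: flat_def eventually_at_right_less intro!: eventually_mono[OF eventually_at_right_less])
  moreover have "(flat j \<longlongrightarrow> 0) (at_left 0)"
    by (rule Lim_transform_eventually[OF tendsto_const])
       (auto simp: flat_def eventually_at_filter)
  ultimately show ?thesis by (simp add: filterlim_split_at)
qed

lemma flat_has_derivative:
  "(flat j has_real_derivative (flat (j + 2) t - of_nat j * flat (j + 1) t)) (at t)"
proof (cases t "0 :: real" rule: linorder_cases)
  case less
  have "((\<lambda>_. 0) has_real_derivative 0) (at t)" by simp
  then have "(flat j has_real_derivative 0) (at t)"
    by (rule has_field_derivative_transform_within_open[where S = "{..<0}"])
       (use less in \<open>auto simp: flat_def\<close>)
  then show ?thesis using less by (simp add: flat_def)
next
  case equal
  \<comment> \<open>The difference quotient at the origin is again a member of the family, so it tends to zero.\<close>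
  have "flat j h / h = flat (Suc j) h" for h
    by (simp add: flat_def divide_inverse)
  then have "((\<lambda>h. (flat j (0 + h) - flat j 0) / h) \<longlongrightarrow> 0) (at 0)"
    using flat_tendsto_0[of "Suc j"] by (simp add: flat_def[of j 0])
  then show ?thesis using equal by (simp add: DERIV_def flat_def)
next
  case greater
  have "((\<lambda>t. inverse t ^ j * exp (- inverse t)) has_real_derivative
      (inverse t ^ j * (exp (- inverse t) * (inverse t * inverse t))
        - of_nat j * inverse t ^ (j + 1) * exp (- inverse t))) (at t)"
    using greater
    by (auto intro!: derivative_eq_intros) (cases j; simp add: field_simps power2_eq_square)
  then have "(flat j has_real_derivative
      (inverse t ^ j * (exp (- inverse t) * (inverse t * inverse t))
        - of_nat j * inverse t ^ (j + 1) * exp (- inverse t))) (at t)"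
    by (rule has_field_derivative_transform_within_open[where S = "{0<..}"])
       (use greater in \<open>auto simp: flat_def\<close>)
  then show ?thesis using greater by (simp add: flat_def power_add power2_eq_square mult_ac)
qed

lemma Ck_on_flat: "Ck_on k UNIV (flat j)"
proof (induction k arbitrary: j)
  case 0
  then show ?case using flat_has_derivative DERIV_isCont
    by (metis Ck_on.simps(1) continuous_at_imp_continuous_on)
next
  case (Suc k)
  have "Ck_on k UNIV (\<lambda>t. flat (j + 2) t + (- of_nat j) * flat (j + 1) t)"
    by (intro Ck_on_add Ck_on_bounded_linear[OF _ bounded_linear_mult_right] Suc) auto
  then show ?case
    using flat_has_derivative[of j]
    by (intro Ck_on_SucI[where f' = "\<lambda>t v. (flat (j + 2) t - of_nat j * flat (j + 1) t) * v"])
       (auto simp: has_field_derivative_def)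
qed

lemma exists_bump:
  fixes a :: "'e::euclidean_space"
  assumes "r > 0"
  shows "\<exists>b. smooth_on UNIV b \<and> b a \<noteq> (0::real) \<and> (\<forall>x. x \<notin> cball a r \<longrightarrow> b x = 0)"
proof (intro exI conjI allI impI)
  let ?b = "\<lambda>x. flat 0 (r\<^sup>2 + - ((x + - a) \<bullet> (x + - a)))"
  show "smooth_on UNIV ?b"
    unfolding smooth_on_def
    by (intro allI Ck_on_compose[OF open_UNIV open_UNIV Ck_on_flat] Ck_on_add Ck_on_const
        Ck_on_bounded_linear[OF _ bounded_linear_minus[OF bounded_linear_ident]]
        Ck_on_bilinear[OF _ bounded_bilinear_inner] Ck_on_id) auto
  show "?b a \<noteq> 0" using assms by (simp add: flat_def)
  show "?b x = 0" if "x \<notin> cball a r" for x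
  proof -
    have "r < norm (x - a)" using that by (simp add: dist_norm norm_minus_commute)
    then have "r\<^sup>2 < (norm (x - a))\<^sup>2" using assms by (simp add: power_strict_mono)
    then show ?thesis by (simp add: flat_def power2_norm_eq_inner)
  qed
qed

section \<open>Smooth functions on a manifold\<close>

lemma smooth_atlas_chart:
  assumes "smooth_atlas A" "(U, c) \<in> A"
  shows "open U" "open (c ` U)" "homeomorphism U (c ` U) c (inv_into U c)"
  using assms by (auto simp: smooth_atlas_def)

lemma smooth_atlas_inv_into:
  assumes "smooth_atlas A" "(U, c) \<in> A" "q \<in> U"
  shows "inv_into U c (c q) = q"
  using homeomorphism_apply1[OF smooth_atlas_chart(3)[OF assms(1,2)] assms(3)] .

lemma open_chart_image:
  assumes "smooth_atlas A" "(U, c) \<in> A" "open W"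
  shows "open (c ` (U \<inter> W))"
proof -
  note chart = smooth_atlas_chart[OF assms(1,2)]
  have "openin (top_of_set (c ` U)) (c ` (U \<inter> W))"
    by (rule homeomorphism_imp_open_map[OF chart(3)]) (use assms(3) in \<open>simp add: openin_open_Int\<close>)
  then show ?thesis using chart(2) by (simp add: openin_open_eq)
qed

lemma smooth_on_cong:
  assumes "open S" "\<And>x. x \<in> S \<Longrightarrow> f x = g x" "smooth_on S f"
  shows "smooth_on S g"
  using Ck_on_cong[OF assms(1,2)] assms(3) by (simp add: smooth_on_def)

lemma smooth_on_subset: "open T \<Longrightarrow> T \<subseteq> S \<Longrightarrow> smooth_on S f \<Longrightarrow> smooth_on T f"
  by (simp add: smooth_on_def Ck_on_subset[of T S])

lemma smooth_on_local:
  assumes "open S" "\<And>x. x \<in> S \<Longrightarrow> \<exists>T. open T \<and> x \<in> T \<and> smooth_on T f"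
  shows "smooth_on S f"
  unfolding smooth_on_def
proof
  show "Ck_on k S f" for k
    by (rule Ck_on_local[OF assms(1)]) (use assms(2) smooth_on_def in metis)
qed

lemma smooth_on_const: "smooth_on S (\<lambda>x. c)"
  by (simp add: smooth_on_def Ck_on_const)

lemma smooth_on_bilinear:
  "open S \<Longrightarrow> bounded_bilinear B \<Longrightarrow> smooth_on S f \<Longrightarrow> smooth_on S g \<Longrightarrow> smooth_on S (\<lambda>x. B (f x) (g x))"
  by (simp add: smooth_on_def Ck_on_bilinear)

lemmas smooth_on_mult = smooth_on_bilinear[OF _ bounded_bilinear_mult]

lemma smooth_on_frechet_derivative:
  assumes "smooth_on S f" "v \<in> Basis"
  shows "smooth_on S (\<lambda>x. frechet_derivative f (at x) v)"
  unfolding smooth_on_def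
proof
  fix k
  have "Ck_on (Suc k) S f" using assms(1) by (simp only: smooth_on_def)
  then show "Ck_on k S (\<lambda>x. frechet_derivative f (at x) v)" using assms(2) by simp
qed

lemma smooth_on_has_derivative:
  assumes "open S" "smooth_on S f" "x \<in> S"
  shows "(f has_derivative frechet_derivative f (at x)) (at x)"
  using Ck_on_Suc_has_derivative[OF assms(1) _ assms(3), of 0 f] assms(2) by (simp only: smooth_on_def)

lemma smooth_on_compose:
  assumes "open S" "open T" "smooth_on T f" "smooth_on S h" "h ` S \<subseteq> T"
  shows "smooth_on S (\<lambda>x. f (h x))"
  unfolding smooth_on_def
proof
  show "Ck_on k S (\<lambda>x. f (h x))" for k
    by (rule Ck_on_compose[OF assms(1,2) _ _ assms(5)]) (use assms(3,4) in \<open>simp_all only: smooth_on_def\<close>)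
qed

lemma smooth_on_add: "open S \<Longrightarrow> smooth_on S f \<Longrightarrow> smooth_on S g \<Longrightarrow> smooth_on S (\<lambda>x. f x + g x)"
  by (simp add: smooth_on_def Ck_on_add)

lemma smooth_fun_add:
  assumes "smooth_atlas A" "smooth_fun A f" "smooth_fun A h"
  shows "smooth_fun A (\<lambda>q. f q + h q)"
  unfolding smooth_fun_def comp_def
proof clarify
  fix U c assume U: "(U, c) \<in> A"
  show "smooth_on (c ` U) (\<lambda>x. f (inv_into U c x) + h (inv_into U c x))"
    by (rule smooth_on_add[OF smooth_atlas_chart(2)[OF assms(1) U]])
       (use assms(2,3) U in \<open>auto simp: smooth_fun_def comp_def\<close>)
qed

lemma smooth_fun_mult:
  assumes "smooth_atlas A" "smooth_fun A f" "smooth_fun A h"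
  shows "smooth_fun A (\<lambda>q. f q * h q)"
  unfolding smooth_fun_def comp_def
proof clarify
  fix U c assume U: "(U, c) \<in> A"
  show "smooth_on (c ` U) (\<lambda>x. f (inv_into U c x) * h (inv_into U c x))"
    by (rule smooth_on_mult[OF smooth_atlas_chart(2)[OF assms(1) U]])
       (use assms(2,3) U in \<open>auto simp: smooth_fun_def comp_def\<close>)
qed

lemma smooth_fun_const: "smooth_fun A (\<lambda>q. r)"
  by (auto simp: smooth_fun_def comp_def smooth_on_const)

text \<open>The Hausdorff axiom enters here: the image of \<open>K\<close> in the manifold is compact, hence closed, so its
  complement is an open set on which the extension vanishes.  Together with \<open>U\<close> it covers the
  manifold.\<close>

lemma smooth_fun_extend_zero:
  assumes A: "smooth_atlas A" and U: "(U, c) \<in> A" and u: "smooth_on (c ` U) u"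
    and K: "compact K" "K \<subseteq> c ` U" and u0: "\<And>x. x \<in> c ` U \<Longrightarrow> x \<notin> K \<Longrightarrow> u x = 0"
  shows "smooth_fun A (\<lambda>q. if q \<in> U then u (c q) else 0)" (is "smooth_fun A ?w")
  unfolding smooth_fun_def
proof clarify
  fix V d assume V: "(V, d) \<in> A"
  note chart = smooth_atlas_chart[OF A U]
  define L where "L = inv_into U c ` K"
  have "continuous_on K (inv_into U c)"
    using homeomorphism_cont2[OF chart(3)] K(2) continuous_on_subset by blast
  then have L: "closed L"
    using K(1) by (simp add: L_def compact_continuous_image compact_imp_closed)
  have w0: "?w q = 0" if "q \<notin> L" for q
  proof (cases "q \<in> U")
    case True
    with that have "c q \<notin> K" using smooth_atlas_inv_into[OF A U True] by (force simp: L_def)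
    with True u0 show ?thesis by simp
  qed simp
  note iV = smooth_atlas_inv_into[OF A V]
  have 1: "smooth_on (d ` (V \<inter> U)) (?w \<circ> inv_into V d)"
  proof (rule smooth_on_cong[OF open_chart_image[OF A V chart(1)]])
    have "smooth_on (d ` (V \<inter> U)) (c \<circ> inv_into V d)"
      using A U V unfolding smooth_atlas_def by blast
    then show "smooth_on (d ` (V \<inter> U)) (\<lambda>x. u ((c \<circ> inv_into V d) x))"
      by (rule smooth_on_compose[OF open_chart_image[OF A V chart(1)] chart(2) u])
         (simp add: image_subset_iff iV)
  qed (auto simp: iV)
  have o: "open (d ` (V \<inter> - L))"
    using L by (intro open_chart_image[OF A V]) (simp add: open_Compl)
  have 2: "smooth_on (d ` (V \<inter> - L)) (?w \<circ> inv_into V d)"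
  proof (rule smooth_on_cong[OF o _ smooth_on_const[of _ 0]])
    fix x assume "x \<in> d ` (V \<inter> - L)"
    then obtain q where q: "q \<in> V" "q \<notin> L" "x = d q" by blast
    show "0 = (?w \<circ> inv_into V d) x" using w0[OF q(2)] iV[OF q(1)] q(3) by (simp split: if_splits)
  qed
  have "L \<subseteq> U" using K(2) by (auto simp: L_def inv_into_into)
  then have "d ` V \<subseteq> d ` (V \<inter> U) \<union> d ` (V \<inter> - L)" by blast
  then have "\<exists>T. open T \<and> x \<in> T \<and> smooth_on T (?w \<circ> inv_into V d)" if "x \<in> d ` V" for x
    using that 1 2 o open_chart_image[OF A V chart(1)] by blast
  then show "smooth_on (d ` V) (?w \<circ> inv_into V d)"
    by (rule smooth_on_local[OF smooth_atlas_chart(2)[OF A V]])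
qed

section \<open>Vector fields through a given tangent vector\<close>

lemma subspace_tangent_space: "subspace (tangent_space A p)"
  unfolding subspace_def tangent_space_def by (simp add: scaleR_fun_def algebra_simps)

lemma vector_field_0: "vector_field A 0"
  using subspace_0[OF subspace_tangent_space, of A]
  by (simp add: vector_field_def vf_deriv_def smooth_fun_const)

lemma vector_field_add:
  assumes "smooth_atlas A" "vector_field A X" "vector_field A Y"
  shows "vector_field A (X + Y)"
  using assms(2,3) smooth_fun_add[OF assms(1)] subspace_add[OF subspace_tangent_space, of _ A]
  by (simp add: vector_field_def vf_deriv_def)

lemma vector_field_fscale:
  assumes "smooth_atlas A" "smooth_fun A f" "vector_field A X"
  shows "vector_field A (f \<cdot> X)"
  using assms(3) smooth_fun_mult[OF assms(1,2)] subspace_scale[OF subspace_tangent_space, of _ A]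
  by (simp add: vector_field_def vf_deriv_def fscale_def scaleR_fun_def)

lemma vector_field_uminus:
  assumes "smooth_atlas A" "vector_field A X" shows "vector_field A (- X)"
proof -
  have "- X = (\<lambda>_. -1) \<cdot> X" by (simp add: fscale_def fun_eq_iff)
  then show ?thesis using vector_field_fscale[OF assms(1) smooth_fun_const assms(2)] by simp
qed

lemma vector_field_diff:
  "smooth_atlas A \<Longrightarrow> vector_field A X \<Longrightarrow> vector_field A Y \<Longrightarrow> vector_field A (X - Y)"
  using vector_field_add[of A X "- Y"] vector_field_uminus[of A Y] by simp

text \<open>The partial derivative in the direction \<open>e\<close> of the chart, cut off by the function \<open>b\<close> of the
  coordinates.  The value \<open>0\<close> on functions that are not smooth is required of tangent vectors.\<close>

definition coord_field ::
  "('m::{t2_space, second_countable_topology}, 'e::euclidean_space) atlas \<Rightarrow> 'm set \<Rightarrow> ('m \<Rightarrow> 'e)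
     \<Rightarrow> ('e \<Rightarrow> real) \<Rightarrow> 'e \<Rightarrow> 'm vfield"
  where "coord_field A U c b e = (\<lambda>q f. if smooth_fun A f \<and> q \<in> U
    then b (c q) * frechet_derivative (f \<circ> inv_into U c) (at (c q)) e else 0)"

lemma vector_field_coord_field:
  assumes A: "smooth_atlas A" and U: "(U, c) \<in> A" and b: "smooth_on UNIV b"
    and K: "compact K" "K \<subseteq> c ` U" and b0: "\<And>x. x \<notin> K \<Longrightarrow> b x = 0" and e: "e \<in> Basis"
  shows "vector_field A (coord_field A U c b e)"
proof -
  let ?i = "inv_into U c" and ?X = "coord_field A U c b e"
  note chart = smooth_atlas_chart[OF A U]
  have sm: "smooth_on (c ` U) (f \<circ> ?i)" if "smooth_fun A f" for f
    using that U by (auto simp: smooth_fun_def)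
  have der: "((f \<circ> ?i) has_derivative frechet_derivative (f \<circ> ?i) (at (c q))) (at (c q))"
    if "smooth_fun A f" "q \<in> U" for f q
    using smooth_on_has_derivative[OF chart(2) sm] that by blast
  have "?X q \<in> tangent_space A q" for q
  proof (cases "q \<in> U")
    case True
    have add: "frechet_derivative ((\<lambda>q. f q + h q) \<circ> ?i) (at (c q)) e
        = frechet_derivative (f \<circ> ?i) (at (c q)) e + frechet_derivative (h \<circ> ?i) (at (c q)) e"
      if "smooth_fun A f" "smooth_fun A h" for f h
      using frechet_derivative_at[OF has_derivative_add[OF der[OF that(1) True] der[OF that(2) True]]]
      by (simp add: comp_def fun_eq_iff)
    have mult: "frechet_derivative ((\<lambda>q. f q * h q) \<circ> ?i) (at (c q)) e
        = f q * frechet_derivative (h \<circ> ?i) (at (c q)) e + frechet_derivative (f \<circ> ?i) (at (c q)) e * h q"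
      if "smooth_fun A f" "smooth_fun A h" for f h
      using frechet_derivative_at[OF has_derivative_mult[OF der[OF that(1) True] der[OF that(2) True]]]
      by (simp add: comp_def fun_eq_iff smooth_atlas_inv_into[OF A U True])
    have "?X q (\<lambda>q. r * f q) = r * ?X q f" if "smooth_fun A f" for r f
      using mult[OF smooth_fun_const[of A r] that] that smooth_fun_mult[OF A smooth_fun_const[of A r] that]
      by (simp add: coord_field_def comp_def frechet_derivative_const)
    moreover have "?X q (\<lambda>q. f q + h q) = ?X q f + ?X q h"
      "?X q (\<lambda>q. f q * h q) = f q * ?X q h + h q * ?X q f" if "smooth_fun A f" "smooth_fun A h" for f h
      using that add[OF that] mult[OF that] smooth_fun_mult[OF A that] smooth_fun_add[OF A that] True
      by (simp_all add: coord_field_def algebra_simps)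
    ultimately show ?thesis by (simp add: tangent_space_def coord_field_def)
  qed (simp add: tangent_space_def coord_field_def)
  moreover have "smooth_fun A (vf_deriv ?X f)" if f: "smooth_fun A f" for f
  proof -
    have "smooth_on (c ` U) (\<lambda>x. b x * frechet_derivative (f \<circ> ?i) (at x) e)"
      using smooth_on_subset[OF chart(2) _ b] sm[OF f] e
      by (intro smooth_on_mult smooth_on_frechet_derivative chart(2)) auto
    from smooth_fun_extend_zero[OF A U this K] b0 f show ?thesis
      by (simp add: vf_deriv_def coord_field_def)
  qed
  ultimately show ?thesis by (simp add: vector_field_def)
qed

lemma sum_fun_apply: "sum F S x = (\<Sum>i\<in>S. F i x)"
  by (induction S rule: infinite_finite_induct) simp_all

text \<open>The fields are the cut-off coordinate fields.  They are told apart at \<open>p\<close> by the coordinate functions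
  relative to \<open>p\<close>, multiplied by the same bump function to make them globally smooth: as these
  vanish at \<open>p\<close>, their derivatives there are those of the coordinates times the nonzero value of
  the bump function.\<close>

lemma exists_vector_fields_independent:
  fixes A :: "('m::{t2_space, second_countable_topology}, 'e::euclidean_space) atlas"
  assumes A: "smooth_atlas A"
  obtains W where "W \<subseteq> {X p | X. vector_field A X}" "independent W" "finite W" "card W = DIM('e)"
proof -
  have "(\<Union>(U, c)\<in>A. U) = UNIV" using A by (simp only: smooth_atlas_def)
  then have "p \<in> (\<Union>(U, c)\<in>A. U)" by simp
  then obtain U c where U: "(U, c) \<in> A" and p: "p \<in> U" by auto
  note chart = smooth_atlas_chart[OF A U]
  obtain r where r: "r > 0" "cball (c p) r \<subseteq> c ` U"
    using chart(2) p open_contains_cball by blast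
  obtain b :: "'e \<Rightarrow> real" where b: "smooth_on UNIV b" "b (c p) \<noteq> 0" "\<forall>x. x \<notin> cball (c p) r \<longrightarrow> b x = 0"
    using exists_bump[OF r(1), of "c p"] by blast
  let ?X = "\<lambda>e. coord_field A U c b e"
  have X: "vector_field A (?X e)" if "e \<in> Basis" for e
    using vector_field_coord_field[OF A U b(1) compact_cball r(2) _ that] b(3) by simp
  define u where "u e x = b x * ((x - c p) \<bullet> e)" for e x
  define f where "f e = (\<lambda>q. if q \<in> U then u e (c q) else 0)" for e
  have u: "smooth_on UNIV (u e)" for e
    unfolding u_def
  proof (rule smooth_on_mult[OF open_UNIV b(1)])
    have "Ck_on k UNIV (\<lambda>x. (x + - c p) \<bullet> e)" for k
      by (intro Ck_on_bounded_linear[OF _ bounded_linear_inner_left] Ck_on_add Ck_on_const Ck_on_id) auto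
    then show "smooth_on UNIV (\<lambda>x. (x - c p) \<bullet> e)" by (simp add: smooth_on_def)
  qed
  have f: "smooth_fun A (f e)" for e
    unfolding f_def using b(3)
    by (intro smooth_fun_extend_zero[OF A U smooth_on_subset[OF chart(2) _ u] compact_cball r(2)])
       (auto simp: u_def)
  have fd: "?X e p (f e') = b (c p) * b (c p) * (e \<bullet> e')" for e e'
  proof -
    let ?b' = "frechet_derivative b (at (c p))"
    have b': "(b has_derivative ?b') (at (c p))"
      using smooth_on_has_derivative[OF open_UNIV b(1)] by simp
    have "((\<lambda>x. (x - c p) \<bullet> e') has_derivative (\<lambda>v. (v - 0) \<bullet> e')) (at (c p))"
      by (intro has_derivative_inner_left has_derivative_diff has_derivative_ident has_derivative_const)
    from has_derivative_mult[OF b' this]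
    have "(u e' has_derivative (\<lambda>v. b (c p) * (v \<bullet> e'))) (at (c p))"
      by (simp add: u_def[abs_def])
    then have "((f e' \<circ> inv_into U c) has_derivative (\<lambda>v. b (c p) * (v \<bullet> e'))) (at (c p))"
      by (rule has_derivative_transform_within_open[OF _ chart(2)])
         (use p smooth_atlas_inv_into[OF A U] in \<open>auto simp: f_def\<close>)
    then show ?thesis
      using f p by (simp add: coord_field_def frechet_derivative_at[symmetric])
  qed
  let ?W = "(\<lambda>e. ?X e p) ` Basis"
  have inj: "inj_on (\<lambda>e. ?X e p) Basis"
  proof (rule inj_onI)
    fix e e' :: 'e assume ee: "e \<in> Basis" "e' \<in> Basis" "?X e p = ?X e' p"
    then have "?X e p (f e) = ?X e' p (f e)" by simp
    then have "e \<bullet> e = e' \<bullet> e" using fd[of e e] fd[of e' e] b(2) by simp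
    then show "e = e'" using ee(1,2) by (simp add: inner_Basis split: if_splits)
  qed
  have fin: "finite ?W" by simp
  have indep: "independent ?W"
  proof
    assume "dependent ?W"
    then obtain a w where w: "w \<in> ?W" "a w \<noteq> 0" and a: "(\<Sum>w\<in>?W. a w *\<^sub>R w) = 0"
      unfolding dependent_finite[OF fin] by (elim exE conjE bexE) (rule that)
    then obtain e where e: "e \<in> Basis" "w = ?X e p" by auto
    have "(\<Sum>e'\<in>Basis. a (?X e' p) *\<^sub>R ?X e' p) = 0"
      using a by (simp add: sum.reindex[OF inj])
    then have "(\<Sum>e'\<in>Basis. a (?X e' p) *\<^sub>R ?X e' p) (f e) = 0" by simp
    then have 0: "(\<Sum>e'\<in>Basis. a (?X e' p) * (b (c p) * b (c p) * (e' \<bullet> e))) = 0"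
      by (simp add: sum_fun_apply scaleR_fun_def fd)
    have "(\<Sum>e'\<in>Basis. a (?X e' p) * (b (c p) * b (c p) * (e' \<bullet> e)))
        = (\<Sum>e'\<in>Basis. if e' = e then a w * (b (c p) * b (c p)) else 0)"
    proof (rule sum.cong[OF refl])
      show "a (?X e' p) * (b (c p) * b (c p) * (e' \<bullet> e))
          = (if e' = e then a w * (b (c p) * b (c p)) else 0)" if "e' \<in> Basis" for e'
        using e that by (cases "e' = e") (simp_all add: inner_Basis)
    qed
    also have "\<dots> = a w * (b (c p) * b (c p))" using e(1) by (simp only: sum.delta finite_Basis if_True)
    finally have "a w * (b (c p) * b (c p)) = 0" unfolding 0 by (rule sym)
    then show False using b(2) w(2) by simp
  qed
  have "?W \<subseteq> {X p | X. vector_field A X}" using X by auto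
  then show thesis using that indep fin by (simp add: card_image[OF inj])
qed

text \<open>Independent vectors at \<open>p\<close> which are values of vector fields number as many as the dimension, so they
  span the tangent space.  That the latter has this dimension is a hypothesis here, since the signature
  of a metric provides it; Hadamard's lemma on derivations is thereby avoided.\<close>

lemma tangent_vector_extends:
  fixes A :: "('m::{t2_space, second_countable_topology}, 'e::euclidean_space) atlas"
  assumes A: "smooth_atlas A" and B: "finite B" "card B = DIM('e)" "span B = tangent_space A p"
    and v: "v \<in> tangent_space A p"
  obtains X where "vector_field A X" "X p = v"
proof -
  let ?V = "{X p | X. vector_field A X}"
  obtain W where W: "W \<subseteq> ?V" "independent W" "finite W" "card W = DIM('e)"
    using exists_vector_fields_independent[OF A] by blast
  have "W \<subseteq> span B" using W(1) B(3) by (auto simp: vector_field_def)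
  have "v \<in> span W"
  proof (rule ccontr)
    assume "v \<notin> span W"
    moreover from this have "v \<notin> W" using span_superset[of W] by blast
    ultimately have "independent (insert v W)" "card (insert v W) = Suc (card W)"
      using W(2,3) by (simp_all add: real_vector.independent_insertI)
    moreover have "insert v W \<subseteq> span B" using \<open>W \<subseteq> span B\<close> v B(3) by simp
    ultimately show False using independent_span_bound[OF B(1)] B(2) W(4) by fastforce
  qed
  have "subspace ?V"
    unfolding subspace_def
  proof (intro conjI ballI allI)
    have "(0 :: 'm vfield) p \<in> ?V" using vector_field_0 by blast
    then show "0 \<in> ?V" by simp
    fix v assume "v \<in> ?V"
    then obtain X where X: "v = X p" "vector_field A X" by blast
    show "r *\<^sub>R v \<in> ?V" for r :: real
    proof -
      have "((\<lambda>_. r) \<cdot> X) p \<in> ?V" using vector_field_fscale[OF A smooth_fun_const X(2)] by blast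
      then show ?thesis by (simp add: fscale_def X(1))
    qed
    fix w assume "w \<in> ?V"
    then obtain Y where Y: "w = Y p" "vector_field A Y" by blast
    show "v + w \<in> ?V"
    proof -
      have "(X + Y) p \<in> ?V" using vector_field_add[OF A X(2) Y(2)] by blast
      then show ?thesis by (simp add: X(1) Y(1))
    qed
  qed
  then have "span W \<subseteq> ?V" using W(1) by (simp add: span_minimal)
  then have "v \<in> ?V" using \<open>v \<in> span W\<close> by blast
  then show thesis using that by blast
qed

text \<open>The metric is nondegenerate at each point because of its pseudo-orthonormal bases.  That it suffices to
  test against vector fields follows from the extension of tangent vectors.\<close>

lemma metric_nondegenerate:
  fixes A :: "('m::{t2_space, second_countable_topology}, 'e::euclidean_space) atlas"
  assumes A: "smooth_atlas A" and g: "pseudo_riemannian_metric A k l g" and kl: "k + l = DIM('e)"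
    and X: "vector_field A X" and 0: "\<And>Z p. vector_field A Z \<Longrightarrow> g p (X p) (Z p) = 0"
  shows "X = 0"
proof
  fix p
  have "has_signature (tangent_space A p) (g p) k l"
    using g by (simp only: pseudo_riemannian_metric_def)
  then obtain P Q where PQ: "finite P" "finite Q" "P \<inter> Q = {}" "card P = k" "card Q = l"
    and span: "span (P \<union> Q) = tangent_space A p"
    and orth: "\<forall>u\<in>P \<union> Q. \<forall>v\<in>P \<union> Q. u \<noteq> v \<longrightarrow> g p u v = 0"
    and norm: "\<forall>u\<in>P. g p u u = 1" "\<forall>u\<in>Q. g p u u = -1"
    unfolding has_signature_def by (elim exE conjE) (rule that)
  have "symmetric_tensor A g" using g by (simp only: pseudo_riemannian_metric_def)
  then have gadd: "g p (u + v) w = g p u w + g p v w" and gscale: "g p (r *\<^sub>R u) w = r * g p u w"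
    if "u \<in> tangent_space A p" "v \<in> tangent_space A p" "w \<in> tangent_space A p" for u v w r
    using that unfolding symmetric_tensor_def by blast+
  let ?T = "tangent_space A p"
  have BT: "P \<union> Q \<subseteq> ?T" unfolding span[symmetric] by (rule span_superset)
  have B: "finite (P \<union> Q)" "card (P \<union> Q) = DIM('e)"
    using PQ kl by (simp_all add: card_Un_disjoint)
  have g0: "g p (X p) w = 0" if w: "w \<in> ?T" for w
  proof -
    obtain Z where "vector_field A Z" "Z p = w"
      using tangent_vector_extends[OF A B span w] by blast
    then show ?thesis using 0 by blast
  qed
  have "X p \<in> span (P \<union> Q)" using X span by (simp add: vector_field_def)
  then obtain a where a: "X p = (\<Sum>v\<in>P \<union> Q. a v *\<^sub>R v)"
    unfolding span_finite[OF B(1)] by blast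
  have lin: "g p (\<Sum>v\<in>S. a v *\<^sub>R v) w = (\<Sum>v\<in>S. a v * g p v w)" if "finite S" "S \<subseteq> ?T" "w \<in> ?T" for S w
    using that(1,2)
  proof (induction S rule: finite_induct)
    case empty
    show ?case using gscale[of w w w 0] that(3) by (simp add: zero_fun_def)
  next
    case (insert v S)
    have v: "v \<in> ?T" "a v *\<^sub>R v \<in> ?T"
      using insert.prems subspace_scale[OF subspace_tangent_space, of v A p] by simp_all
    have S: "(\<Sum>v\<in>S. a v *\<^sub>R v) \<in> ?T"
      using insert.prems
      by (intro subspace_sum[OF subspace_tangent_space] subspace_scale[OF subspace_tangent_space]) blast
    show ?case
      using insert.IH insert.prems
      by (simp only: sum.insert[OF insert.hyps] gadd[OF v(2) S that(3)] gscale[OF v(1) v(1) that(3)]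
          insert_subset)
  qed
  have "a w = 0" if w: "w \<in> P \<union> Q" for w
  proof -
    have wT: "w \<in> ?T" using w BT by blast
    have "g p (X p) w = (\<Sum>v\<in>P \<union> Q. a v * g p v w)"
      unfolding a by (rule lin[OF B(1) BT wT])
    also have "\<dots> = (\<Sum>v\<in>P \<union> Q. if v = w then a w * g p w w else 0)"
      using orth w by (intro sum.cong) auto
    also have "\<dots> = a w * g p w w" using B(1) w by simp
    finally have "a w * g p w w = 0" using g0[OF wT] by simp
    moreover have "g p w w \<noteq> 0" using w norm by auto
    ultimately show ?thesis by simp
  qed
  then show "X p = 0 p" using a by simp
qed

section \<open>Almost contact complex Riemannian manifolds: pointwise algebra\<close>

locale levi_civita_contact_manifold =
  fixes n :: nat
    and A :: "('m::{t2_space, second_countable_topology}, 'e::euclidean_space) atlas"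
    and \<phi> :: "'m \<Rightarrow> 'm tvec \<Rightarrow> 'm tvec" and \<xi> :: "'m vfield"
    and \<eta> :: "'m \<Rightarrow> 'm tvec \<Rightarrow> real" and g :: "'m \<Rightarrow> 'm tvec \<Rightarrow> 'm tvec \<Rightarrow> real"
    and D :: "'m vfield \<Rightarrow> 'm vfield \<Rightarrow> 'm vfield"
  assumes acc_riemannian: "almost_contact_complex_riemannian n A \<phi> \<xi> \<eta> g"
    and connection: "levi_civita A g D"
begin

abbreviation "T \<equiv> tangent_space A"
abbreviation "vf \<equiv> vector_field A"

lemma atlas: "smooth_atlas A"
  using acc_riemannian by (simp only: almost_contact_complex_riemannian_def)

lemma dim_eq: "(n + 1) + n = DIM('e)"
  using acc_riemannian by (simp add: almost_contact_complex_riemannian_def)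

lemma g_metric: "pseudo_riemannian_metric A (n + 1) n g"
  using acc_riemannian by (simp only: almost_contact_complex_riemannian_def)

lemma phi_endomorphism: "endomorphism_field A \<phi>" and eta_one_form: "one_form A \<eta>" and g_tensor: "symmetric_tensor A g"
  using acc_riemannian
  by (simp_all only: almost_contact_complex_riemannian_def pseudo_riemannian_metric_def)

lemma xi_vf [simp]: "vf \<xi>"
  using acc_riemannian by (simp only: almost_contact_complex_riemannian_def)

lemma T_add [simp]: "v \<in> T p \<Longrightarrow> w \<in> T p \<Longrightarrow> v + w \<in> T p"
  and T_diff [simp]: "v \<in> T p \<Longrightarrow> w \<in> T p \<Longrightarrow> v - w \<in> T p"
  and T_minus [simp]: "v \<in> T p \<Longrightarrow> - v \<in> T p"
  and T_scale [simp]: "v \<in> T p \<Longrightarrow> r *\<^sub>R v \<in> T p"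
  by (simp_all add: subspace_tangent_space subspace_add subspace_diff subspace_neg subspace_scale)

lemma vf_T [simp]: "vf X \<Longrightarrow> X p \<in> T p"
  by (simp add: vector_field_def)

lemma phi_T [simp]: "v \<in> T p \<Longrightarrow> \<phi> p v \<in> T p"
  using phi_endomorphism by (simp add: endomorphism_field_def)

lemma phi_add: "v \<in> T p \<Longrightarrow> w \<in> T p \<Longrightarrow> \<phi> p (v + w) = \<phi> p v + \<phi> p w"
  and phi_scale: "v \<in> T p \<Longrightarrow> \<phi> p (r *\<^sub>R v) = r *\<^sub>R \<phi> p v"
  using phi_endomorphism unfolding endomorphism_field_def by simp_all

lemma phi_minus: "v \<in> T p \<Longrightarrow> \<phi> p (- v) = - \<phi> p v"
  using phi_scale[of v p "-1"] by simp

lemma phi_diff: "v \<in> T p \<Longrightarrow> w \<in> T p \<Longrightarrow> \<phi> p (v - w) = \<phi> p v - \<phi> p w"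
  using phi_add[of v p "- w"] phi_minus[of w p] by simp

lemmas phi_linear = phi_add phi_scale phi_minus phi_diff

lemma eta_add: "v \<in> T p \<Longrightarrow> w \<in> T p \<Longrightarrow> \<eta> p (v + w) = \<eta> p v + \<eta> p w"
  and eta_scale: "v \<in> T p \<Longrightarrow> \<eta> p (r *\<^sub>R v) = r * \<eta> p v"
  using eta_one_form unfolding one_form_def by simp_all

lemma eta_minus: "v \<in> T p \<Longrightarrow> \<eta> p (- v) = - \<eta> p v"
  using eta_scale[of v p "-1"] by simp

lemma eta_diff: "v \<in> T p \<Longrightarrow> w \<in> T p \<Longrightarrow> \<eta> p (v - w) = \<eta> p v - \<eta> p w"
  using eta_add[of v p "- w"] eta_minus[of w p] by simp

lemmas eta_linear = eta_add eta_scale eta_minus eta_diff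

lemma g_sym: "v \<in> T p \<Longrightarrow> w \<in> T p \<Longrightarrow> g p v w = g p w v"
  and g_add: "u \<in> T p \<Longrightarrow> v \<in> T p \<Longrightarrow> w \<in> T p \<Longrightarrow> g p (u + v) w = g p u w + g p v w"
  and g_scale: "v \<in> T p \<Longrightarrow> w \<in> T p \<Longrightarrow> g p (r *\<^sub>R v) w = r * g p v w"
  using g_tensor unfolding symmetric_tensor_def by blast+

lemma g_minus: "v \<in> T p \<Longrightarrow> w \<in> T p \<Longrightarrow> g p (- v) w = - g p v w"
  using g_scale[of v p w "-1"] by simp

lemma g_diff: "u \<in> T p \<Longrightarrow> v \<in> T p \<Longrightarrow> w \<in> T p \<Longrightarrow> g p (u - v) w = g p u w - g p v w"
  using g_add[of u p "- v" w] g_minus[of v p w] by simp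

lemma g_right:
  "u \<in> T p \<Longrightarrow> v \<in> T p \<Longrightarrow> w \<in> T p \<Longrightarrow> g p w (u + v) = g p w u + g p w v"
  "v \<in> T p \<Longrightarrow> w \<in> T p \<Longrightarrow> g p w (r *\<^sub>R v) = r * g p w v"
  "v \<in> T p \<Longrightarrow> w \<in> T p \<Longrightarrow> g p w (- v) = - g p w v"
  "u \<in> T p \<Longrightarrow> v \<in> T p \<Longrightarrow> w \<in> T p \<Longrightarrow> g p w (u - v) = g p w u - g p w v"
  by (simp_all add: g_sym[of w] g_add g_scale g_minus g_diff)

lemmas g_linear = g_add g_scale g_minus g_diff g_right

lemma phi_xi [simp]: "\<phi> p (\<xi> p) = 0"
  and eta_xi [simp]: "\<eta> p (\<xi> p) = 1"
  and phi_phi: "v \<in> T p \<Longrightarrow> \<phi> p (\<phi> p v) = - v + \<eta> p v *\<^sub>R \<xi> p"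
  and eta_phi [simp]: "v \<in> T p \<Longrightarrow> \<eta> p (\<phi> p v) = 0"
  and g_phi_phi: "v \<in> T p \<Longrightarrow> w \<in> T p \<Longrightarrow> g p (\<phi> p v) (\<phi> p w) = - g p v w + \<eta> p v * \<eta> p w"
  using acc_riemannian by (simp_all only: almost_contact_complex_riemannian_def)

lemma g_0: "w \<in> T p \<Longrightarrow> g p 0 w = 0" "w \<in> T p \<Longrightarrow> g p w 0 = 0"
  using g_scale[of w p w 0] g_right(2)[of w p w 0] by simp_all

text \<open>The compatibility condition at \<open>\<xi>\<close>, where \<open>\<phi>\<close> vanishes.\<close>

lemma g_xi: "v \<in> T p \<Longrightarrow> g p (\<xi> p) v = \<eta> p v" "v \<in> T p \<Longrightarrow> g p v (\<xi> p) = \<eta> p v"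
proof -
  assume v: "v \<in> T p"
  show "g p (\<xi> p) v = \<eta> p v" using g_phi_phi[OF vf_T[OF xi_vf] v] v by (simp add: g_0)
  then show "g p v (\<xi> p) = \<eta> p v" using v by (simp add: g_sym)
qed

text \<open>The compatibility condition at \<open>\<phi> v\<close> and \<open>w\<close>, with \<open>\<xi>\<close> orthogonal to the image of \<open>\<phi>\<close>.  So
  \<open>\<phi>\<close> is self-adjoint, whereas it is skew on almost contact metric manifolds, where the compatibility
  condition has the opposite sign.\<close>

lemma g_phi:
  assumes v: "v \<in> T p" and w: "w \<in> T p"
  shows "g p (\<phi> p v) w = g p v (\<phi> p w)"
  using g_phi_phi[OF phi_T[OF v] w] v w by (simp add: phi_phi g_linear g_xi)

lemma app_simps:
  "app \<phi> X p = \<phi> p (X p)" "app \<eta> X p = \<eta> p (X p)" "app2 g X Y p = g p (X p) (Y p)"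
  by (simp_all add: app_def app2_def)

lemma vf_app [simp]: "vf X \<Longrightarrow> vf (app \<phi> X)"
  using phi_endomorphism unfolding endomorphism_field_def by blast

lemma smooth_eta [simp]: "vf X \<Longrightarrow> smooth_fun A (app \<eta> X)"
  using eta_one_form unfolding one_form_def by blast

lemma smooth_g [simp]: "vf X \<Longrightarrow> vf Y \<Longrightarrow> smooth_fun A (app2 g X Y)"
  using g_tensor unfolding symmetric_tensor_def by blast

lemma vf_ops [simp]:
  "vf X \<Longrightarrow> vf Y \<Longrightarrow> vf (X + Y)" "vf X \<Longrightarrow> vf Y \<Longrightarrow> vf (X - Y)" "vf X \<Longrightarrow> vf (- X)"
  "smooth_fun A f \<Longrightarrow> vf X \<Longrightarrow> vf (f \<cdot> X)"
  using atlas vector_field_add vector_field_diff vector_field_uminus vector_field_fscale by blast+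

section \<open>The Levi-Civita connection and the structure tensors\<close>

lemma D_affine: "affine_connection A D"
  using connection by (simp only: levi_civita_def)

lemma D_vf [simp]: "vf X \<Longrightarrow> vf Y \<Longrightarrow> vf (D X Y)"
  and D_add: "vf X \<Longrightarrow> vf Y \<Longrightarrow> vf Z \<Longrightarrow> D (X + Y) Z = D X Z + D Y Z"
    "vf X \<Longrightarrow> vf Y \<Longrightarrow> vf Z \<Longrightarrow> D X (Y + Z) = D X Y + D X Z"
  and D_fscale: "smooth_fun A f \<Longrightarrow> vf X \<Longrightarrow> vf Y \<Longrightarrow> D (f \<cdot> X) Y = f \<cdot> D X Y"
    "smooth_fun A f \<Longrightarrow> vf X \<Longrightarrow> vf Y \<Longrightarrow> D X (f \<cdot> Y) = vf_deriv X f \<cdot> Y + f \<cdot> D X Y"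
  using D_affine unfolding affine_connection_def by blast+

lemma torsion_free: "vf X \<Longrightarrow> vf Y \<Longrightarrow> lie_bracket X Y = D X Y - D Y X"
  using connection unfolding levi_civita_def by simp

lemma D_metric:
  assumes "vf X" "vf Y" "vf Z"
  shows "X p (app2 g Y Z) = g p (D X Y p) (Z p) + g p (Y p) (D X Z p)"
proof -
  have "vf_deriv X (app2 g Y Z) = app2 g (D X Y) Z + app2 g Y (D X Z)"
    using connection assms unfolding levi_civita_def by blast
  from fun_cong[OF this, of p] show ?thesis by (simp add: vf_deriv_def app_simps)
qed

text \<open>A derivation kills the constant \<open>1\<close>, because \<open>1 * 1 = 1\<close>.\<close>

lemma vf_const [simp]:
  assumes "vf X" shows "X p (\<lambda>_. c) = 0"
proof -
  have X: "X p \<in> T p" using assms by simp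
  have "X p (\<lambda>q. (\<lambda>_. 1) q * (\<lambda>_. 1) q) = 1 * X p (\<lambda>_. 1) + 1 * X p (\<lambda>_. 1)"
    using X smooth_fun_const[of A 1] unfolding tangent_space_def by blast
  then have "X p (\<lambda>_. 1) = 0" by simp
  moreover have "X p (\<lambda>q. c * (\<lambda>_. 1) q) = c * X p (\<lambda>_. 1)"
    using X smooth_fun_const[of A 1] unfolding tangent_space_def by blast
  ultimately show ?thesis by simp
qed

lemma uminus_eq_fscale: "- X = (\<lambda>_. - 1) \<cdot> (X :: 'm vfield)"
  by (simp add: fscale_def fun_eq_iff)

lemma D_uminus:
  assumes "vf X" "vf Y"
  shows "D (- X) Y = - D X Y" "D X (- Y) = - D X Y"
  using assms unfolding uminus_eq_fscale
  by (simp_all add: D_fscale smooth_fun_const) (simp add: fun_eq_iff fscale_def vf_deriv_def)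

lemma D_diff:
  assumes "vf X" "vf Y" "vf Z"
  shows "D (X - Y) Z = D X Z - D Y Z" "D X (Y - Z) = D X Y - D X Z"
  using D_add(1)[of X "- Y" Z] D_add(2)[of X Y "- Z"] assms by (simp_all add: D_uminus)

lemma fscale_apply: "(f \<cdot> X) p = f p *\<^sub>R X p"
  by (simp add: fscale_def)

text \<open>Since \<open>\<xi>\<close> is dual to \<open>\<eta>\<close>, the tensor \<open>H\<close> below is \<open>(\<nabla>\<^sub>x \<eta>) y\<close>, which is
  \<open>nabla_form_eta\<close>; \<open>F\<close> is the fundamental tensor at a point.\<close>

abbreviation "E \<equiv> nabla_endo D \<phi>"
abbreviation "F x y z p \<equiv> g p (E x y p) (z p)"
abbreviation "H x y p \<equiv> g p (D x \<xi> p) (y p)"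

lemma E_apply: "E x y p = D x (app \<phi> y) p - \<phi> p (D x y p)"
  by (simp add: nabla_endo_def app_simps)

lemma E_vf [simp]: "vf x \<Longrightarrow> vf y \<Longrightarrow> vf (E x y)"
  by (simp add: nabla_endo_def)

text \<open>The Leibniz terms of \<open>D x (\<phi> y)\<close> and \<open>\<phi> (D x y)\<close> cancel.  The form with a difference is the one
  met when a horizontal part is split off.\<close>

lemma E_tensorial:
  assumes "vf x" "vf y" "vf w" "smooth_fun A f"
  shows "E (x - f \<cdot> w) y p = E x y p - f p *\<^sub>R E w y p"
    and "E x (y - f \<cdot> w) p = E x y p - f p *\<^sub>R E x w p"
proof -
  show "E (x - f \<cdot> w) y p = E x y p - f p *\<^sub>R E w y p"
    using assms by (simp add: E_apply D_diff D_fscale fscale_apply phi_linear scaleR_diff_right)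
  have "app \<phi> (y - f \<cdot> w) = app \<phi> y - f \<cdot> app \<phi> w"
    using assms by (intro ext) (simp add: app_simps fscale_apply phi_linear)
  then show "E x (y - f \<cdot> w) p = E x y p - f p *\<^sub>R E x w p"
    using assms
    by (simp add: E_apply D_diff D_fscale fscale_apply phi_linear scaleR_diff_right app_simps)
qed

text \<open>Covariant derivatives of a self-adjoint endomorphism are self-adjoint.\<close>

lemma F_sym:
  assumes "vf x" "vf y" "vf z"
  shows "F x y z p = F x z y p"
proof -
  have "app2 g (app \<phi> y) z = app2 g y (app \<phi> z)"
    using assms by (intro ext) (simp add: app_simps g_phi)
  then have "g p (D x (app \<phi> y) p) (z p) + g p (\<phi> p (y p)) (D x z p)
      = g p (D x y p) (\<phi> p (z p)) + g p (y p) (D x (app \<phi> z) p)"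
    using D_metric[of x "app \<phi> y" z p] D_metric[of x y "app \<phi> z" p] assms by (simp add: app_simps)
  then show ?thesis
    using assms by (simp add: E_apply g_linear g_phi g_sym[of "y p"])
qed

lemma nabla_form_eta:
  assumes "vf x" "vf y"
  shows "nabla_form D \<eta> x y p = H x y p"
proof -
  have "app \<eta> y = app2 g \<xi> y"
    using assms by (intro ext) (simp add: app_simps g_xi)
  then show ?thesis
    using D_metric[of x \<xi> y p] assms by (simp add: nabla_form_def vf_deriv_def app_simps g_xi)
qed

text \<open>The vector field \<open>\<xi>\<close> has constant length.\<close>

lemma H_xi:
  assumes "vf x" shows "H x \<xi> p = 0"
proof -
  have "app2 g \<xi> \<xi> = (\<lambda>_. 1)"
    by (intro ext) (simp add: app_simps g_xi)
  then show ?thesis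
    using D_metric[of x \<xi> \<xi> p] assms by (simp add: g_sym[of "\<xi> p"])
qed

text \<open>Differentiation of \<open>\<eta> \<circ> \<phi> = 0\<close>.\<close>

lemma F_xi:
  assumes "vf x" "vf y"
  shows "F x y \<xi> p = - H x (app \<phi> y) p"
proof -
  have "app \<eta> (app \<phi> y) = (\<lambda>_. 0)"
    using assms by (intro ext) (simp add: app_simps)
  then have "H x (app \<phi> y) p = - \<eta> p (D x (app \<phi> y) p)"
    using assms nabla_form_eta[of x "app \<phi> y" p] by (simp add: nabla_form_def vf_deriv_def app_simps)
  then show ?thesis
    using assms by (simp add: E_apply g_xi eta_linear)
qed

lemma app_phi_phi: "vf y \<Longrightarrow> app \<phi> (app \<phi> y) = app \<eta> y \<cdot> \<xi> - y"
  by (intro ext) (simp add: app_simps fscale_apply phi_phi)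

text \<open>Differentiation of \<open>\<phi>\<^sup>2 = - I + \<eta> \<otimes> \<xi>\<close>.  On horizontal fields it says that \<open>\<nabla>\<phi>\<close> anticommutes
  with \<open>\<phi>\<close>, up to a multiple of \<open>\<xi>\<close>.\<close>

lemma F_phi:
  assumes "vf x" "vf y" "vf z"
  shows "F x (app \<phi> y) z p + F x y (app \<phi> z) p = H x y p * \<eta> p (z p) + \<eta> p (y p) * H x z p"
proof -
  have "D x (app \<phi> (app \<phi> y)) p
      = x p (app \<eta> y) *\<^sub>R \<xi> p + \<eta> p (y p) *\<^sub>R D x \<xi> p - D x y p"
    using assms by (simp add: app_phi_phi D_diff D_fscale fscale_apply vf_deriv_def app_simps)
  moreover have "x p (app \<eta> y) = H x y p + \<eta> p (D x y p)"
    using nabla_form_eta[OF assms(1,2), of p] by (simp add: nabla_form_def vf_deriv_def app_simps)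
  ultimately have "g p (D x (app \<phi> (app \<phi> y)) p) (z p)
      = (H x y p + \<eta> p (D x y p)) * \<eta> p (z p) + \<eta> p (y p) * H x z p - g p (D x y p) (z p)"
    using assms by (simp add: g_linear g_xi)
  then show ?thesis
    using assms by (simp add: E_apply app_simps g_linear g_phi phi_phi g_xi algebra_simps)
qed

definition hor :: "'m vfield \<Rightarrow> 'm vfield"
  where "hor x = x - app \<eta> x \<cdot> \<xi>"

lemma hor_vf [simp]: "vf x \<Longrightarrow> vf (hor x)"
  by (simp add: hor_def)

lemma hor_apply: "hor x p = x p - \<eta> p (x p) *\<^sub>R \<xi> p"
  by (simp add: hor_def fscale_apply app_simps)

lemma eta_hor [simp]: "vf x \<Longrightarrow> \<eta> p (hor x p) = 0"
  by (simp add: hor_apply eta_linear)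

lemma horizontal_hor [simp]: "vf x \<Longrightarrow> horizontal A \<eta> (hor x)"
  by (simp add: horizontal_def fun_eq_iff app_simps)

text \<open>The vertical part has a nonconstant coefficient, which can be taken out because \<open>F\<close> is a tensor.\<close>

lemma F_hor_left:
  "vf x \<Longrightarrow> vf y \<Longrightarrow> vf z \<Longrightarrow> F (hor x) y z p = F x y z p - \<eta> p (x p) * F \<xi> y z p"
  by (simp add: hor_def E_tensorial app_simps g_linear)

lemma F_hor_mid:
  "vf x \<Longrightarrow> vf y \<Longrightarrow> vf z \<Longrightarrow> F x (hor y) z p = F x y z p - \<eta> p (y p) * F x \<xi> z p"
  by (simp add: hor_def E_tensorial app_simps g_linear)

lemma F_hor_right:
  "vf x \<Longrightarrow> vf y \<Longrightarrow> vf z \<Longrightarrow> F x y (hor z) p = F x y z p - \<eta> p (z p) * F x y \<xi> p"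
  by (simp add: hor_apply g_linear)

lemma F_xi_xi: "vf x \<Longrightarrow> F x \<xi> \<xi> p = 0"
  using F_xi[of x \<xi> p] by (simp add: app_simps g_0)

lemma g_hor:
  "vf x \<Longrightarrow> vf y \<Longrightarrow> g p (hor x p) (hor y p) = g p (x p) (y p) - \<eta> p (x p) * \<eta> p (y p)"
  by (simp add: hor_apply g_linear eta_linear g_xi)

section \<open>Sasaki-like manifolds and the formula for the covariant derivative\<close>

text \<open>The formula for \<open>\<nabla>\<phi>\<close>, paired with a third vector field.  As an equation between numbers it can be
  checked component by component.\<close>

definition nabla_phi_formula :: bool
  where "nabla_phi_formula \<longleftrightarrow> (\<forall>x y z p. vf x \<longrightarrow> vf y \<longrightarrow> vf z \<longrightarrow>
    F x y z p = - g p (x p) (y p) * \<eta> p (z p) - \<eta> p (y p) * g p (x p) (z p)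
      + 2 * \<eta> p (x p) * \<eta> p (y p) * \<eta> p (z p))"

text \<open>Split \<open>y\<close> and \<open>z\<close> into horizontal and vertical parts: by the symmetry of \<open>F\<close> in these slots and the
  vanishing of \<open>F x \<xi> \<xi>\<close>, all components are then given by the two hypotheses.\<close>

lemma nabla_phi_formulaI:
  assumes hh: "\<And>x y z p. vf x \<Longrightarrow> vf y \<Longrightarrow> vf z \<Longrightarrow> F x (hor y) (hor z) p = 0"
    and hx: "\<And>x y p. vf x \<Longrightarrow> vf y \<Longrightarrow> F x y \<xi> p = - g p (x p) (y p) + \<eta> p (x p) * \<eta> p (y p)"
  shows nabla_phi_formula
  unfolding nabla_phi_formula_def
proof (intro allI impI)
  fix x y z p assume v: "vf x" "vf y" "vf z"
  have "F x y z p = \<eta> p (y p) * F x \<xi> z p + \<eta> p (z p) * F x y \<xi> p"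
    using hh[of x y z p] v by (simp add: F_hor_mid F_hor_right F_xi_xi)
  then show "F x y z p = - g p (x p) (y p) * \<eta> p (z p) - \<eta> p (y p) * g p (x p) (z p)
      + 2 * \<eta> p (x p) * \<eta> p (y p) * \<eta> p (z p)"
    using F_sym[of x \<xi> z p] v hx[of x y p] hx[of x z p] by (simp add: algebra_simps)
qed

lemma sasaki_like_iff_nabla_phi_formula: "sasaki_like A \<phi> \<xi> \<eta> g D \<longleftrightarrow> nabla_phi_formula"
proof
  assume s: "sasaki_like A \<phi> \<xi> \<eta> g D"
  have s: "F x y z p = 0" "F \<xi> y z p = 0" "F \<xi> \<xi> z p = 0" "F x y \<xi> p = - g p (x p) (y p)"
    if "horizontal A \<eta> x" "horizontal A \<eta> y" "horizontal A \<eta> z" for x y z p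
    using s that unfolding sasaki_like_def fundamental_tensor_def
    by (auto simp: fun_eq_iff app_simps)
  have s1: "F \<xi> y \<xi> p = 0" if "vf y" for y p
    using s(3)[of "hor y" "hor y" "hor y" p] F_hor_right[of \<xi> \<xi> y p] F_sym[of \<xi> y \<xi> p] that
    by (simp add: F_xi_xi)
  show nabla_phi_formula
  proof (rule nabla_phi_formulaI)
    fix x y z p assume v: "vf x" "vf y" "vf z"
    show "F x (hor y) (hor z) p = 0"
      using s(1,2)[of "hor x" "hor y" "hor z" p] F_hor_left[of x "hor y" "hor z" p] v by simp
    show "F x y \<xi> p = - g p (x p) (y p) + \<eta> p (x p) * \<eta> p (y p)"
      using s(4)[of "hor x" "hor y" "hor y" p] F_hor_left[of x "hor y" \<xi> p] F_hor_mid[of x y \<xi> p]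
        s1[of "hor y" p] v
      by (simp add: F_xi_xi g_hor)
  qed
next
  assume nabla_phi_formula
  then have F: "F x y z p = - g p (x p) (y p) * \<eta> p (z p) - \<eta> p (y p) * g p (x p) (z p)
      + 2 * \<eta> p (x p) * \<eta> p (y p) * \<eta> p (z p)" if "vf x" "vf y" "vf z" for x y z p
    using that by (simp only: nabla_phi_formula_def)
  show "sasaki_like A \<phi> \<xi> \<eta> g D"
    unfolding sasaki_like_def
  proof (intro allI impI)
    fix X Y Z assume h: "horizontal A \<eta> X" "horizontal A \<eta> Y" "horizontal A \<eta> Z"
    then have v: "vf X" "vf Y" "vf Z" by (simp_all add: horizontal_def)
    have e: "\<eta> p (X p) = 0" "\<eta> p (Y p) = 0" "\<eta> p (Z p) = 0" for p
      using h by (simp_all add: horizontal_def fun_eq_iff app_simps)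
    show "fundamental_tensor D \<phi> g X Y Z = 0 \<and> fundamental_tensor D \<phi> g \<xi> Y Z = 0 \<and>
        fundamental_tensor D \<phi> g \<xi> \<xi> Z = 0 \<and> fundamental_tensor D \<phi> g X Y \<xi> = - app2 g X Y"
      using v by (auto simp: fun_eq_iff fundamental_tensor_def app_simps F e g_xi(1))
  qed
qed

text \<open>Passing from the pairings back to the vector fields uses that the metric is nondegenerate against vector
  fields, which rests on bump functions.\<close>

lemma nabla_phi_iff_nabla_phi_formula:
  "(\<forall>x y. vf x \<longrightarrow> vf y \<longrightarrow> E x y =
      - (app2 g x y \<cdot> \<xi>) - app \<eta> y \<cdot> x + (\<lambda>p. 2 * app \<eta> x p * app \<eta> y p) \<cdot> \<xi>) \<longleftrightarrow> nabla_phi_formula"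
  (is "(\<forall>x y. _ \<longrightarrow> _ \<longrightarrow> E x y = ?R x y) \<longleftrightarrow> _")
proof -
  have R: "vf (?R x y)" if "vf x" "vf y" for x y
    using that smooth_fun_mult[OF atlas smooth_fun_mult[OF atlas smooth_fun_const smooth_eta] smooth_eta]
    by simp
  have gR: "g p (?R x y p) (z p) = - g p (x p) (y p) * \<eta> p (z p) - \<eta> p (y p) * g p (x p) (z p)
      + 2 * \<eta> p (x p) * \<eta> p (y p) * \<eta> p (z p)" if "vf x" "vf y" "vf z" for x y z p
    using that by (simp add: fscale_apply app_simps g_linear g_xi)
  show ?thesis
  proof
    assume "\<forall>x y. vf x \<longrightarrow> vf y \<longrightarrow> E x y = ?R x y"
    then have E: "E x y = ?R x y" if "vf x" "vf y" for x y using that by blast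
    show nabla_phi_formula
      unfolding nabla_phi_formula_def
    proof (intro allI impI)
      fix x y z p assume v: "vf x" "vf y" "vf z"
      show "F x y z p = - g p (x p) (y p) * \<eta> p (z p) - \<eta> p (y p) * g p (x p) (z p)
          + 2 * \<eta> p (x p) * \<eta> p (y p) * \<eta> p (z p)"
        unfolding E[OF v(1,2)] by (rule gR[OF v])
    qed
  next
    assume F: nabla_phi_formula
    show "\<forall>x y. vf x \<longrightarrow> vf y \<longrightarrow> E x y = ?R x y"
    proof (intro allI impI)
      fix x y assume v: "vf x" "vf y"
      have "E x y - ?R x y = 0"
      proof (rule metric_nondegenerate[OF atlas g_metric dim_eq])
        show "vf (E x y - ?R x y)" using v R[OF v] by simp
        show "g p ((E x y - ?R x y) p) (Z p) = 0" if "vf Z" for Z p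
        proof -
          have "g p ((E x y - ?R x y) p) (Z p) = F x y Z p - g p (?R x y p) (Z p)"
            using v that R[OF v] by (simp only: minus_apply g_diff vf_T E_vf)
          then show ?thesis using F v that by (simp only: nabla_phi_formula_def gR[OF v that])
        qed
      qed
      then show "E x y = ?R x y" by (simp only: right_minus_eq)
    qed
  qed
qed

section \<open>The Nijenhuis tensors\<close>

text \<open>The tensor whose skew part and symmetric part, up to the factor \<open>2\<close>, are \<open>[\<phi>,\<phi>]\<close> and \<open>{\<phi>,\<phi>}\<close>.\<close>

definition P :: "'m vfield \<Rightarrow> 'm vfield \<Rightarrow> 'm vfield"
  where "P x y = E (app \<phi> x) y - app \<phi> (E x y)"

text \<open>Rewrite \<open>D u (\<phi> v)\<close> as \<open>E u v + \<phi> (D u v)\<close> in either bracket: the terms \<open>\<phi> (D u v)\<close> cancel against those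
  with \<open>\<phi>\<close> in front of the bracket.\<close>

lemma nijenhuis_P:
  assumes "vf x" "vf y"
  shows "nijenhuis_of_bracket lie_bracket \<phi> x y p = P x y p - P y x p"
    and "nijenhuis_of_bracket (sym_bracket D) \<phi> x y p = P x y p + P y x p"
  using assms
  by (simp_all add: nijenhuis_of_bracket_def torsion_free sym_bracket_def P_def E_apply app_simps phi_linear)

lemma lie_derivative_metric_xi:
  assumes "vf x" "vf y"
  shows "lie_derivative_metric \<xi> g x y p = H x y p + H y x p"
  using assms D_metric[of \<xi> x y p]
  by (simp add: lie_derivative_metric_def torsion_free vf_deriv_def app_simps g_linear g_sym[of "x p"])

lemma nijenhuis_apply:
  assumes "vf x" "vf y"
  shows "nijenhuis_tensor D \<phi> \<xi> \<eta> x y p = P x y p - P y x p + (H x y p - H y x p) *\<^sub>R \<xi> p"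
    and "associated_nijenhuis_tensor D \<phi> \<xi> g x y p = P x y p + P y x p + (H x y p + H y x p) *\<^sub>R \<xi> p"
  using assms
  by (simp_all add: nijenhuis_tensor_def associated_nijenhuis_tensor_def nijenhuis_P fscale_apply
      exterior_derivative_def nabla_form_eta lie_derivative_metric_xi)

definition nijenhuis_conditions :: bool
  where "nijenhuis_conditions \<longleftrightarrow> (\<forall>x y. vf x \<longrightarrow> vf y \<longrightarrow> nijenhuis_tensor D \<phi> \<xi> \<eta> x y = 0 \<and>
      associated_nijenhuis_tensor D \<phi> \<xi> g x y =
        (\<lambda>p. - 4 * (app2 (associated_metric \<phi> \<eta> g) x y p - app \<eta> x p * app \<eta> y p)) \<cdot> \<xi>)"

lemma nijenhuis_rhs_apply:
  "((\<lambda>p. - 4 * (app2 (associated_metric \<phi> \<eta> g) x y p - app \<eta> x p * app \<eta> y p)) \<cdot> \<xi>) p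
    = (- 4 * g p (x p) (\<phi> p (y p))) *\<^sub>R \<xi> p"
  by (simp add: fscale_apply app_simps app2_def associated_metric_def)

text \<open>The formula makes \<open>P\<close> symmetric and a multiple of \<open>\<xi>\<close>, and applied to \<open>\<phi> y\<close> and \<open>\<xi>\<close> it gives
  \<open>(\<nabla>\<^sub>x \<eta>) y = - g (x, \<phi> y)\<close>, so that \<open>\<eta>\<close> is closed.  Half of the \<open>\<xi>\<close>-component of the associated
  tensor stems from \<open>P\<close>, the other half from the Lie derivative of the metric.\<close>

lemma nabla_phi_imp_nijenhuis_conditions:
  assumes E: "\<And>x y. vf x \<Longrightarrow> vf y \<Longrightarrow> E x y =
      - (app2 g x y \<cdot> \<xi>) - app \<eta> y \<cdot> x + (\<lambda>p. 2 * app \<eta> x p * app \<eta> y p) \<cdot> \<xi>"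
  shows nijenhuis_conditions
  unfolding nijenhuis_conditions_def
proof (intro allI impI)
  have Ep: "E x y p = - (g p (x p) (y p) *\<^sub>R \<xi> p) - \<eta> p (y p) *\<^sub>R x p + (2 * \<eta> p (x p) * \<eta> p (y p)) *\<^sub>R \<xi> p"
    if "vf x" "vf y" for x y p
    using that by (simp add: E fscale_apply app_simps)
  have H: "H x y p = - g p (x p) (\<phi> p (y p))" if v: "vf x" "vf y" for x y p
  proof -
    have "F x (app \<phi> y) \<xi> p = - g p (x p) (\<phi> p (y p))"
      using v by (simp add: Ep app_simps eta_linear g_xi)
    moreover have "H x (app \<phi> (app \<phi> y)) p = - H x y p"
      using v H_xi[of x p] by (simp add: app_simps phi_phi g_linear)
    ultimately show ?thesis using F_xi[of x "app \<phi> y" p] v by simp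
  qed
  have P: "P x y p = (- g p (x p) (\<phi> p (y p))) *\<^sub>R \<xi> p" if v: "vf x" "vf y" for x y p
    using v by (simp add: P_def Ep app_simps phi_linear g_phi)
  fix x y assume v: "vf x" "vf y"
  have s: "g p (y p) (\<phi> p (x p)) = g p (x p) (\<phi> p (y p))" for p
    using v g_phi[of "y p" p "x p"] g_sym[of "x p" p "\<phi> p (y p)"] by simp
  show "nijenhuis_tensor D \<phi> \<xi> \<eta> x y = 0 \<and> associated_nijenhuis_tensor D \<phi> \<xi> g x y =
        (\<lambda>p. - 4 * (app2 (associated_metric \<phi> \<eta> g) x y p - app \<eta> x p * app \<eta> y p)) \<cdot> \<xi>"
  proof
    show "nijenhuis_tensor D \<phi> \<xi> \<eta> x y = 0"
    proof
      fix p
      show "nijenhuis_tensor D \<phi> \<xi> \<eta> x y p = 0 p" using v by (simp add: nijenhuis_apply H P s)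
    qed
    show "associated_nijenhuis_tensor D \<phi> \<xi> g x y =
        (\<lambda>p. - 4 * (app2 (associated_metric \<phi> \<eta> g) x y p - app \<eta> x p * app \<eta> y p)) \<cdot> \<xi>"
    proof
      fix p
      show "associated_nijenhuis_tensor D \<phi> \<xi> g x y p =
        ((\<lambda>p. - 4 * (app2 (associated_metric \<phi> \<eta> g) x y p - app \<eta> x p * app \<eta> y p)) \<cdot> \<xi>) p"
        unfolding nijenhuis_rhs_apply
        using v by (simp add: nijenhuis_apply H P s scaleR_left_distrib[symmetric] flip: scaleR_minus_left)
    qed
  qed
qed

text \<open>Adding the two conditions removes the transposed terms and leaves an equation for \<open>P x y\<close> alone, called
  \<open>star\<close> below when it is paired with \<open>z\<close>.  For horizontal \<open>y\<close> and \<open>z\<close> it reads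
  \<open>F (\<phi> x) y z = F x y (\<phi> z)\<close>.  The left side is symmetric in \<open>y\<close> and \<open>z\<close>, so \<open>\<phi>\<close> can be moved from
  \<open>z\<close> to \<open>y\<close> without change, whereas differentiating \<open>\<phi>\<^sup>2\<close> moves it with a change of sign; hence
  \<open>F x\<close> vanishes on horizontal fields.  Comparing the equation for \<open>(\<xi>, z)\<close> with the one for
  \<open>(z, \<xi>)\<close>, which have the same term \<open>F (\<phi> x) \<xi> z\<close>, determines \<open>\<nabla>\<eta>\<close> and with it the remaining
  components.\<close>

lemma nijenhuis_conditions_imp_nabla_phi_formula:
  assumes N: nijenhuis_conditions
  shows nabla_phi_formula
proof -
  have star: "F (app \<phi> x) y z p - F x y (app \<phi> z) p + H x y p * \<eta> p (z p)
      = - 2 * g p (x p) (\<phi> p (y p)) * \<eta> p (z p)" if v: "vf x" "vf y" "vf z" for x y z p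
  proof -
    have P: "vf (P x y)" "vf (P y x)" using v by (simp_all add: P_def)
    have "nijenhuis_tensor D \<phi> \<xi> \<eta> x y p = 0"
      "associated_nijenhuis_tensor D \<phi> \<xi> g x y p = (- 4 * g p (x p) (\<phi> p (y p))) *\<^sub>R \<xi> p"
      using N v unfolding nijenhuis_conditions_def nijenhuis_rhs_apply[symmetric] by simp_all
    then have "g p (nijenhuis_tensor D \<phi> \<xi> \<eta> x y p) (z p) = 0"
      "g p (associated_nijenhuis_tensor D \<phi> \<xi> g x y p) (z p)
        = - 4 * g p (x p) (\<phi> p (y p)) * \<eta> p (z p)"
      using v by (simp_all add: g_0 g_linear g_xi)
    moreover have "g p (nijenhuis_tensor D \<phi> \<xi> \<eta> x y p) (z p)
        = g p (P x y p) (z p) - g p (P y x p) (z p) + (H x y p - H y x p) * \<eta> p (z p)"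
      "g p (associated_nijenhuis_tensor D \<phi> \<xi> g x y p) (z p)
        = g p (P x y p) (z p) + g p (P y x p) (z p) + (H x y p + H y x p) * \<eta> p (z p)"
      using v P by (simp_all add: nijenhuis_apply g_linear g_xi)
    ultimately have "2 * g p (P x y p) (z p) + 2 * (H x y p * \<eta> p (z p))
        = - 4 * g p (x p) (\<phi> p (y p)) * \<eta> p (z p)"
      by (simp add: algebra_simps)
    moreover have "g p (P x y p) (z p) = F (app \<phi> x) y z p - F x y (app \<phi> z) p"
      using v by (simp add: P_def app_simps g_linear g_phi)
    ultimately show ?thesis by simp
  qed
  have hh: "F x y z p = 0" if v: "vf x" "vf y" "vf z" and e: "\<And>q. \<eta> q (y q) = 0" "\<And>q. \<eta> q (z q) = 0"
    for x y z p
  proof -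
    have 0: "F x y (app \<phi> z) p = 0" if v: "vf x" "vf y" "vf z" and e: "\<eta> p (y p) = 0" "\<eta> p (z p) = 0" for x y z
    proof -
      have "F x y (app \<phi> z) p = F (app \<phi> x) y z p" using star[OF v, of p] e by simp
      also have "\<dots> = F (app \<phi> x) z y p" using v by (simp add: F_sym)
      also have "\<dots> = F x z (app \<phi> y) p" using star[of x z y p] v e by simp
      also have "\<dots> = F x (app \<phi> y) z p" using v by (simp add: F_sym)
      also have "\<dots> = - F x y (app \<phi> z) p" using F_phi[OF v, of p] e by simp
      finally show ?thesis by simp
    qed
    \<comment> \<open>On horizontal fields \<open>\<phi>\<^sup>2 = - I\<close>, so the factor \<open>\<phi>\<close> in the last slot can be removed.\<close>
    have "F x y (app \<phi> (app \<phi> z)) p = 0" using v e(1) by (intro 0) (simp_all add: app_simps)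
    then show ?thesis using v e by (simp add: app_simps phi_phi g_linear)
  qed
  have Hh: "H x z p = - g p (x p) (\<phi> p (z p))" if v: "vf x" "vf z" and e: "\<eta> p (z p) = 0" for x z p
  proof -
    have "H x (app \<phi> (app \<phi> z)) p = - H x z p" using v e by (simp add: app_simps phi_phi g_linear)
    then have "F x \<xi> (app \<phi> z) p = H x z p"
      using v F_sym[of x \<xi> "app \<phi> z" p] F_xi[of x "app \<phi> z" p] by simp
    then have "F (app \<phi> x) \<xi> z p = H x z p" using star[of x \<xi> z p] v e by simp
    moreover have "F (app \<phi> x) z \<xi> p = - 2 * g p (x p) (\<phi> p (z p)) - H x z p"
      using star[of x z \<xi> p] v by (simp add: app_simps g_0)
    ultimately show ?thesis using F_sym[of "app \<phi> x" z \<xi> p] v by simp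
  qed
  show nabla_phi_formula
  proof (rule nabla_phi_formulaI)
    fix x y z p assume v: "vf x" "vf y" "vf z"
    show "F x (hor y) (hor z) p = 0" using v by (intro hh) simp_all
    show "F x y \<xi> p = - g p (x p) (y p) + \<eta> p (x p) * \<eta> p (y p)"
      using v Hh[of x "app \<phi> y" p] F_xi[of x y p] by (simp add: app_simps phi_phi g_linear g_xi)
  qed
qed

end

theorem theorem8p2:
  fixes n :: nat
    and A :: "('m::{t2_space, second_countable_topology}, 'e::euclidean_space) atlas"
    and \<phi> :: "'m \<Rightarrow> 'm tvec \<Rightarrow> 'm tvec"
    and \<xi> :: "'m vfield"
    and \<eta> :: "'m \<Rightarrow> 'm tvec \<Rightarrow> real"
    and g :: "'m \<Rightarrow> 'm tvec \<Rightarrow> 'm tvec \<Rightarrow> real"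
    and D :: "'m vfield \<Rightarrow> 'm vfield \<Rightarrow> 'm vfield"
  defines "i \<equiv> sasaki_like A \<phi> \<xi> \<eta> g D"
    and "ii \<equiv> (\<forall>x y. vector_field A x \<longrightarrow> vector_field A y \<longrightarrow>
          nabla_endo D \<phi> x y =
            - (app2 g x y \<cdot> \<xi>) - app \<eta> y \<cdot> x + (\<lambda>p. 2 * app \<eta> x p * app \<eta> y p) \<cdot> \<xi>)"
    and "iii \<equiv> (\<forall>x y. vector_field A x \<longrightarrow> vector_field A y \<longrightarrow>
          nijenhuis_tensor D \<phi> \<xi> \<eta> x y = 0 \<and>
          associated_nijenhuis_tensor D \<phi> \<xi> g x y =
            (\<lambda>p. - 4 * (app2 (associated_metric \<phi> \<eta> g) x y p - app \<eta> x p * app \<eta> y p)) \<cdot> \<xi>)"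
  assumes "almost_contact_complex_riemannian n A \<phi> \<xi> \<eta> g"
    and "levi_civita A g D"
  shows "(i \<longleftrightarrow> ii) \<and> (ii \<longleftrightarrow> iii)"
proof -
  interpret levi_civita_contact_manifold n A \<phi> \<xi> \<eta> g D
    using assms(4,5) by unfold_locales
  have iii: "iii \<longleftrightarrow> nijenhuis_conditions" by (simp only: iii_def nijenhuis_conditions_def)
  have "i \<longleftrightarrow> nabla_phi_formula" unfolding i_def by (rule sasaki_like_iff_nabla_phi_formula)
  moreover have ii: "ii \<longleftrightarrow> nabla_phi_formula" unfolding ii_def by (rule nabla_phi_iff_nabla_phi_formula)
  moreover have "iii" if ii
    unfolding iii using that unfolding ii_def by (intro nabla_phi_imp_nijenhuis_conditions) blast
  moreover have "nabla_phi_formula" if iii using that nijenhuis_conditions_imp_nabla_phi_formula unfolding iii by blast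
  ultimately show ?thesis by blast
qed

end
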